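(* With $g_n$ and $\Phi(t)=\sum_{n\ge1}g_n\dfrac{t^n}{(n-1)!}$ as defined in the context, and real/imaginary parts of formal series taken coefficientwise, $$\operatorname{Re}\Phi(t)=\frac{t^2e^t}{\sinh 2t},$$ that is, $\operatorname{Re}g_{2k+1}=(1-2^{2k-1})B_{2k}$ for $k\ge0$ and $\operatorname{Re}g_{2k}=\dfrac{(2k-1)E_{2k-2}}2$ for $k\ge1$; moreover $\operatorname{Im}g_{2k}=0$ for $k\ge1$. Here $B_{j}$ are the Bernoulli numbers and $E_{j}$ the Euler numbers ($\operatorname{sech}t=\sum_j E_{2j}t^{2j}/(2j)!$). Furthermore $\nu_2(\operatorname{Re}g_n)=-1$ for every $n\ge1$, where $\nu_2$ is the $2$-adic valuation on $\mathbb Q$.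
   Context: For $\nu$ and $k\ge0$ let $a_k(\nu)=\dfrac{\prod_{j=0}^{k-1}(4\nu^2-(2j+1)^2)}{8^k k!}$, a polynomial in $\nu^2$. Let $p=1+i$, $q=1-i$. For parameters $\alpha,\beta$ put $A=\alpha^2$, $B=\beta^2$, $G_n=\sum_{l=0}^n a_l(\alpha)a_{n-l}(\beta)p^lq^{n-l}$ and $F(Z)=\sum_{n\ge0}\dfrac{G_n}{(Z-1)(Z-2)\cdots(Z-n)}$, a formal power series in $Z^{-1}$ (each summand expanded at $Z=\infty$) with constant term $1$. Write $\log F=\sum_{n\ge1}L_nZ^{-n}$; each $L_n$ is a polynomial in $A,B$ with coefficients in $\mathbb Q(i)$. Define $g_n=\partial_A L_n\big|_{A=B=0}$. *)

theory Defs
  imports "HOL-Computational_Algebra.Computational_Algebra"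
begin

text \<open>
  The ring \<open>\<complex>[A, B]\<close> is represented by the type \<^typ>\<open>complex poly poly\<close>, with \<open>A\<close> the outer and
  \<open>B\<close> the inner variable. Hence \<open>\<partial>\<^sub>A\<close> is \<^const>\<open>pderiv\<close>, and \<open>poly (poly P [:a:]) b\<close> is the value of
  \<open>P\<close> at \<open>A = a\<close>, \<open>B = b\<close>.
\<close>

definition varA :: "complex poly poly" where "varA = [:0, 1:]"

definition varB :: "complex poly poly" where "varB = [:[:0, 1:]:]"

definition const_AB :: "complex \<Rightarrow> complex poly poly" where "const_AB c = [:[:c:]:]"

definition a_num :: "nat \<Rightarrow> complex \<Rightarrow> complex" where
  "a_num k \<nu> = (\<Prod>j<k. 4 * \<nu>\<^sup>2 - (2 * of_nat j + 1)\<^sup>2) / (8 ^ k * fact k)"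

text \<open>The same coefficient, with the polynomial \<open>x\<close> in place of \<open>\<nu>\<^sup>2\<close>.\<close>

definition a_pol :: "nat \<Rightarrow> complex poly poly \<Rightarrow> complex poly poly" where
  "a_pol k x = const_AB (1 / (8 ^ k * fact k)) * (\<Prod>j<k. 4 * x - (2 * of_nat j + 1)\<^sup>2)"

lemma poly_a_pol:
  "poly (poly (a_pol k varA) [:\<alpha>\<^sup>2:]) b = a_num k \<alpha>"
  "poly (poly (a_pol k varB) a) (\<beta>\<^sup>2) = a_num k \<beta>"
  by (simp_all add: a_pol_def a_num_def const_AB_def varA_def varB_def poly_prod mult.commute)

definition G :: "nat \<Rightarrow> complex poly poly" where
  "G n = (\<Sum>l\<le>n. a_pol l varA * a_pol (n - l) varB * const_AB ((1 + \<i>) ^ l * (1 - \<i>) ^ (n - l)))"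

text \<open>
  Series in \<open>Z\<^sup>-\<^sup>1\<close> are formal power series in \<^const>\<open>fps_X\<close> \<open>= Z\<^sup>-\<^sup>1\<close>, so that
  \<open>1 / ((Z - 1) \<cdots> (Z - n)) = X\<^sup>n / ((1 - X) \<cdots> (1 - n X))\<close>.
\<close>

definition inv_falling :: "nat \<Rightarrow> complex fps" where
  "inv_falling n = fps_X ^ n / (\<Prod>j=1..n. 1 - of_nat j * fps_X)"

definition lift_fps :: "complex fps \<Rightarrow> complex poly poly fps" where
  "lift_fps f = Abs_fps (\<lambda>m. const_AB (fps_nth f m))"

text \<open>
  The coefficient of \<open>X\<^sup>m\<close> in the \<open>n\<close>-th summand vanishes for \<open>n > m\<close>; lemma \<open>F_sums\<close> below shows that
  this is the infinite sum with respect to the usual topology on formal power series.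
\<close>

definition F :: "complex poly poly fps" where
  "F = Abs_fps (\<lambda>m. \<Sum>n\<le>m. G n * fps_nth (lift_fps (inv_falling n)) m)"

lemma inv_falling_nth_eq_0: "m < n \<Longrightarrow> fps_nth (inv_falling n) m = 0"
proof -
  assume "m < n"
  have "fps_nth (\<Prod>j\<in>S. 1 - of_nat j * fps_X :: complex fps) 0 = 1" if "finite S" for S
    using that by induction auto
  then have "fps_nth (\<Prod>j=1..n. 1 - of_nat j * fps_X :: complex fps) 0 \<noteq> 0" by simp
  then show ?thesis
    using \<open>m < n\<close> by (simp add: inv_falling_def fps_divide_unit fps_X_power_mult_nth)
qed

lemma F_sums: "(\<lambda>n. fps_const (G n) * lift_fps (inv_falling n)) sums F"
  unfolding sums_def
proof (rule tendsto_fpsI)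
  fix m
  have "fps_nth (\<Sum>n<N. fps_const (G n) * lift_fps (inv_falling n)) m = fps_nth F m" if "m < N" for N
  proof -
    have "fps_nth (\<Sum>n<N. fps_const (G n) * lift_fps (inv_falling n)) m
        = (\<Sum>n<N. G n * fps_nth (lift_fps (inv_falling n)) m)"
      by (simp add: fps_sum_nth)
    also have "\<dots> = (\<Sum>n\<le>m. G n * fps_nth (lift_fps (inv_falling n)) m)"
      using that
      by (intro sum.mono_neutral_right) (auto simp: lift_fps_def const_AB_def inv_falling_nth_eq_0)
    finally show ?thesis by (simp add: F_def)
  qed
  then show "\<forall>\<^sub>F N in sequentially.
      fps_nth (\<Sum>n<N. fps_const (G n) * lift_fps (inv_falling n)) m = fps_nth F m"
    by (auto simp: eventually_at_top_dense)
qed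

text \<open>
  \<^const>\<open>fps_ln\<close> is only available over fields, so the series \<open>fps_ln 1\<close> of \<open>log (1 + X)\<close> is lifted to
  \<open>\<complex>[A, B]\<close> before composing it with \<open>F - 1\<close>.
\<close>

definition L :: "nat \<Rightarrow> complex poly poly" where
  "L n = fps_nth (lift_fps (fps_ln 1) oo (F - 1)) n"

definition g :: "nat \<Rightarrow> complex" where
  "g n = poly (poly (pderiv (L n)) 0) 0"

definition Phi :: "complex fps" where
  "Phi = Abs_fps (\<lambda>n. if n = 0 then 0 else g n / fact (n - 1))"

definition fps_Re :: "complex fps \<Rightarrow> real fps" where
  "fps_Re f = Abs_fps (\<lambda>n. Re (fps_nth f n))"

definition fps_sinh :: "real \<Rightarrow> real fps" where
  "fps_sinh c = (fps_exp c - fps_exp (- c)) / 2"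

definition fps_cosh :: "real \<Rightarrow> real fps" where
  "fps_cosh c = (fps_exp c + fps_exp (- c)) / 2"

text \<open>Bernoulli numbers, by \<open>t / (e\<^sup>t - 1) = \<Sum>\<^sub>n B\<^sub>n t\<^sup>n / n!\<close> (so \<open>B\<^sub>1 = -1/2\<close>).\<close>

definition bernoulli :: "nat \<Rightarrow> real" where
  "bernoulli n = fact n * fps_nth (fps_X / (fps_exp 1 - 1)) n"

text \<open>Euler numbers, by \<open>sech t = \<Sum>\<^sub>n E\<^sub>n t\<^sup>n / n!\<close> (the odd ones vanish).\<close>

definition euler :: "nat \<Rightarrow> real" where
  "euler n = fact n * fps_nth (1 / fps_cosh 1) n"

text \<open>
  The \<open>p\<close>-adic valuation of a nonzero rational number. At \<open>0\<close>, where the valuation is \<open>\<infinity>\<close>, this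
  function has the value \<open>0\<close>.
\<close>

definition padic_val :: "nat \<Rightarrow> rat \<Rightarrow> int" where
  "padic_val p r = (case quotient_of r of (a, b) \<Rightarrow>
     int (multiplicity (int p) a) - int (multiplicity (int p) b))"

end

theory Submission
  imports Defs
begin

text \<open>
  Since \<open>1 / ((Z - 1) \<cdots> (Z - n)) = \<Gamma>(Z - n) / \<Gamma>(Z)\<close>, the series \<open>F\<close> is the formal Mellin transform
  \<open>\<Gamma>(Z)\<^sup>-\<^sup>1 \<integral> t\<^sup>Z\<^sup>-\<^sup>1 e\<^sup>-\<^sup>t f(1/t) g(1/t) dt\<close>, where \<open>f\<close>, \<open>g\<close> have the coefficients
  \<open>a\<^sub>l(\<alpha>) p\<^sup>l\<close> and \<open>a\<^sub>l(\<beta>) q\<^sup>l\<close>. By the asymptotic expansion of the Bessel function \<open>K\<close>, up to a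
  constant the integrand is \<open>t\<^sup>Z u(t) v(t)\<close> with \<open>u(t) = K\<^sub>\<alpha>(c t)\<close>, \<open>v(t) = K\<^sub>\<beta>(d t)\<close>,
  \<open>c = 1/p = (1 - i)/2\<close>, \<open>d = 1/q = (1 + i)/2\<close> (note \<open>c + d = 1\<close>). Put \<open>\<theta> = t d/dt\<close>. Because
  \<open>c\<^sup>2 + d\<^sup>2 = 0\<close>, the Bessel equations give a small closed system for \<open>u v\<close>,
  \<open>u \<theta>v - v \<theta>u\<close>, \<open>\<theta>(u v)\<close> and \<open>\<theta>u \<theta>v\<close>; the Mellin transform turns \<open>\<theta>\<close> into multiplication by a
  linear polynomial in \<open>Z\<close> and \<open>t\<close> into the shift \<open>Z \<mapsto> Z + 1\<close>. The result is a pair of difference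
  equations for \<open>F\<close> over \<open>\<complex>[A, B]\<close>, lemmas \<open>flux_series_eq\<close> and \<open>F_eq_flux_series\<close>.

  At \<open>A = B = 0\<close> they give \<open>(Z + 1)\<^sup>2 F(Z) = Z (Z + 2) F(Z + 4)\<close>. Conjugating the
  coefficients exchanges \<open>A\<close> and \<open>B\<close>, so with \<open>g(Z) = \<Sum> g\<^sub>n Z\<^sup>-\<^sup>n\<close> the series \<open>Re g\<close> and \<open>Im g\<close> are,
  up to the factors \<open>2\<close> and \<open>2 i\<close>, the logarithmic derivatives of \<open>F\<close> in the directions \<open>(1, 1)\<close> and
  \<open>(1, -1)\<close>. In the first direction the equations become
  \<open>Re g(Z) - Re g(Z + 4) = 2 / (Z + 1)\<^sup>2\<close>. The Borel transform \<open>Z\<^sup>-\<^sup>n\<^sup>-\<^sup>1 \<mapsto> t\<^sup>n / n!\<close> replaces the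
  shift by \<open>e\<^sup>-\<^sup>4\<^sup>t\<close>, so that \<open>\<phi>(t) = \<Sum> Re g\<^sub>n\<^sub>+\<^sub>1 t\<^sup>n / n!\<close> satisfies
  \<open>\<phi>(t) (1 - e\<^sup>-\<^sup>4\<^sup>t) = 2 t e\<^sup>-\<^sup>t\<close>; this is the formula for \<open>Re \<Phi>\<close>. Its even and odd parts in
  \<open>2 \<phi> = t / sinh t + t / cosh t\<close> give the Bernoulli and Euler numbers.

  In the second direction \<open>Im g(Z) - Im g(Z + 4)\<close> is an explicit rational function times the ratio
  \<open>W(Z) = F(Z + 2) / F(Z)\<close> at \<open>A = B = 0\<close>. The equation \<open>W(Z) W(Z + 2) = (Z + 1)\<^sup>2 / (Z (Z + 2))\<close>
  determines \<open>W\<close>, and it is also solved by \<open>W(-Z)\<close>; so \<open>W\<close> is even. Hence \<open>Im g(Z) - Im g(Z + 4)\<close> is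
  invariant under \<open>Z \<mapsto> - Z - 4\<close>, which forces \<open>Im g\<close> to be odd.

  For the valuation, comparing coefficients in \<open>\<phi>(t) (e\<^sup>2\<^sup>t - e\<^sup>-\<^sup>2\<^sup>t) = 2 t e\<^sup>t\<close> writes
  \<open>2 Re g\<^sub>n\<^sub>+\<^sub>1 - 1\<close> as a combination of the earlier \<open>2 Re g\<^sub>j\<^sub>+\<^sub>1\<close> with coefficients that are even
  integers over odd integers. By induction every \<open>2 Re g\<^sub>n\<close> is a quotient of odd integers.
\<close>

section \<open>The first-order system satisfied by a product of two Bessel series\<close>

text \<open>
  The Bessel equation in the variable \<open>y = 1/t\<close>, with the factor \<open>t\<^sup>-\<^sup>1\<^sup>/\<^sup>2 e\<^sup>-\<^sup>c\<^sup>t\<close> divided out. The recurrence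
  for the coefficients is the one of \<open>a\<^sub>n(\<nu>) c\<^sup>-\<^sup>n\<close> with \<open>a = \<nu>\<^sup>2\<close>.
\<close>

lemma bessel_ode:
  fixes f :: "'a::comm_ring_1 fps"
  assumes rec: "\<And>n. 8 * c * of_nat (Suc n) * fps_nth f (Suc n) = (4 * a - (2 * of_nat n + 1)\<^sup>2) * fps_nth f n"
  shows "4 * fps_X\<^sup>2 * fps_deriv (fps_deriv f) + 8 * fps_X * fps_deriv f + f + 8 * fps_const c * fps_deriv f
    = 4 * fps_const a * f"
proof (rule fps_ext)
  fix n
  have num: "numeral k * h = fps_const (numeral k) * h" for k and h :: "'a fps"
    by (simp add: numeral_fps_const)
  have X2: "fps_nth (fps_X\<^sup>2 * fps_deriv (fps_deriv f)) n = of_nat n * (of_nat n - 1) * fps_nth f n"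
  proof (cases "n < 2")
    case True
    then show ?thesis by (auto simp: fps_X_power_mult_nth less_2_cases_iff)
  next
    case False
    then obtain m where "n = m + 2" by (metis add.commute le_Suc_ex not_less)
    then show ?thesis by (simp add: fps_X_power_mult_nth distrib_left distrib_right mult.assoc)
  qed
  have X1: "fps_nth (fps_X * fps_deriv f) n = of_nat n * fps_nth f n"
    by (cases n) auto
  have "fps_nth (4 * fps_X\<^sup>2 * fps_deriv (fps_deriv f) + 8 * fps_X * fps_deriv f + f + 8 * fps_const c * fps_deriv f) n
     = 4 * (of_nat n * (of_nat n - 1) * fps_nth f n) + 8 * (of_nat n * fps_nth f n) + fps_nth f n
       + 8 * c * of_nat (Suc n) * fps_nth f (Suc n)"
    unfolding mult.assoc num fps_add_nth fps_mult_left_const_nth X2 X1 by simp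
  also have "\<dots> = 4 * a * fps_nth f n"
    unfolding rec by (simp add: algebra_simps power2_eq_square)
  also have "\<dots> = fps_nth (4 * fps_const a * f) n"
    by (simp add: num mult.assoc)
  finally show "fps_nth (4 * fps_X\<^sup>2 * fps_deriv (fps_deriv f) + 8 * fps_X * fps_deriv f + f + 8 * fps_const c * fps_deriv f) n = fps_nth (4 * fps_const a * f) n" .
qed

text \<open>
  If \<open>u = t\<^sup>-\<^sup>1\<^sup>/\<^sup>2 e\<^sup>-\<^sup>c\<^sup>t f(1/t)\<close>, then \<open>\<theta>u = - t/2 \<cdot> t\<^sup>-\<^sup>1\<^sup>/\<^sup>2 e\<^sup>-\<^sup>c\<^sup>t w(1/t)\<close> for \<open>\<theta> = t d/dt\<close> and
  \<open>w\<close> the series defined here. Taking out the factor \<open>t/2\<close> leaves no positive power of \<open>t\<close> in \<open>w\<close>.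
\<close>

definition bessel_flux :: "'a::comm_ring_1 \<Rightarrow> 'a fps \<Rightarrow> 'a fps" where
  "bessel_flux c f = 2 * fps_X\<^sup>2 * fps_deriv f + (fps_X + 2 * fps_const c) * f"

text \<open>
  The second half of the Bessel equation as a first-order system in \<open>f\<close> and its flux; the first half is
  the definition of the flux. Working with the system avoids third derivatives of products.
\<close>

lemma bessel_flux_deriv:
  fixes f :: "'a::comm_ring_1 fps"
  assumes rec: "\<And>n. 8 * c * of_nat (Suc n) * fps_nth f (Suc n) = (4 * a - (2 * of_nat n + 1)\<^sup>2) * fps_nth f n"
  shows "2 * fps_X\<^sup>2 * fps_deriv (bessel_flux c f)
    = (fps_X - 2 * fps_const c) * bessel_flux c f
      + 4 * (fps_const a * fps_X\<^sup>2 + (fps_const c)\<^sup>2) * f"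
proof -
  have num: "fps_deriv (numeral k :: 'a fps) = 0" for k
    by (simp add: numeral_fps_const)
  have "2 * fps_X\<^sup>2 * fps_deriv (bessel_flux c f)
    - ((fps_X - 2 * fps_const c) * bessel_flux c f + 4 * (fps_const a * fps_X\<^sup>2 + (fps_const c)\<^sup>2) * f)
    = fps_X\<^sup>2 * (4 * fps_X\<^sup>2 * fps_deriv (fps_deriv f) + 8 * fps_X * fps_deriv f + f + 8 * fps_const c * fps_deriv f
      - 4 * fps_const a * f)"
    by (simp only: bessel_flux_def num fps_deriv_add fps_deriv_mult fps_deriv_fps_X fps_deriv_const power2_eq_square)
      (simp add: algebra_simps del: fps_const_mult)
  also have "\<dots> = 0"
    using bessel_ode[OF rec] by simp
  finally show ?thesis by simp
qed

text \<open>
  \<open>\<theta>(t\<^sup>-\<^sup>1 e\<^sup>-\<^sup>t h(1/t)) = - e\<^sup>-\<^sup>t k(1/t)\<close>, where \<open>k\<close> is the image of \<open>h\<close>. The weight \<open>t\<^sup>-\<^sup>1 e\<^sup>-\<^sup>t\<close> is the one of the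
  product \<open>u v\<close>, since \<open>c + d = 1\<close>.
\<close>

definition by_parts_op :: "'a::comm_ring_1 fps \<Rightarrow> 'a fps" where
  "by_parts_op h = h + fps_X * h + fps_X\<^sup>2 * fps_deriv h"

text \<open>
  The relations on \<open>c\<close>, \<open>d\<close> are those of \<open>1/p\<close> and \<open>1/q\<close>. The second one makes the terms with \<open>t\<^sup>2\<close> cancel in
  \<open>\<theta>\<^sup>2(u v)\<close>, which is what keeps the resulting recurrence short.
\<close>

locale bessel_product =
  fixes c d a b :: "'a::{idom,ring_char_0}" and f g :: "'a fps"
  assumes cd: "c + d = 1" "c\<^sup>2 + d\<^sup>2 = 0"
  assumes rec_f: "\<And>n. 8 * c * of_nat (Suc n) * fps_nth f (Suc n) = (4 * a - (2 * of_nat n + 1)\<^sup>2) * fps_nth f n"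
  assumes rec_g: "\<And>n. 8 * d * of_nat (Suc n) * fps_nth g (Suc n) = (4 * b - (2 * of_nat n + 1)\<^sup>2) * fps_nth g n"
begin

definition "product = f * g"
definition "flux_sum = f * bessel_flux d g + g * bessel_flux c f"
definition "flux_diff = g * bessel_flux c f - f * bessel_flux d g"
definition "flux_prod = bessel_flux c f * bessel_flux d g"

lemma cd_fps: "fps_const d = 1 - fps_const c" "2 * (fps_const c * fps_const c) = 2 * fps_const c - 1"
proof -
  have d: "d = 1 - c" using cd(1) by (simp add: algebra_simps)
  then show "fps_const d = 1 - fps_const c" by (metis fps_const_1_eq_1 fps_const_sub)
  have "2 * (c * c) = 2 * c - 1"
    using cd(2) unfolding d by (simp add: algebra_simps power2_eq_square)
  then have "fps_const (2 * (c * c)) = fps_const (2 * c - 1)" by simp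
  then show "2 * (fps_const c * fps_const c) = 2 * fps_const c - 1"
    by (simp add: numeral_fps_const flip: fps_const_mult fps_const_sub)
qed

lemma flux_sum_eq: "flux_sum = 2 * by_parts_op product"
  unfolding flux_sum_def product_def by_parts_op_def bessel_flux_def fps_deriv_mult using cd_fps by algebra

lemma f_deriv: "2 * (fps_X\<^sup>2 * fps_deriv f) = bessel_flux c f - (fps_X + 2 * fps_const c) * f"
  and g_deriv: "2 * (fps_X\<^sup>2 * fps_deriv g) = bessel_flux d g - (fps_X + 2 * fps_const d) * g"
  by (simp_all add: bessel_flux_def)

lemmas derivs = f_deriv g_deriv bessel_flux_deriv[OF rec_f, unfolded mult.assoc] bessel_flux_deriv[OF rec_g, unfolded mult.assoc]

text \<open>
  With the weight \<open>e\<^sup>-\<^sup>t\<close> restored, \<open>flux_diff\<close> is twice \<open>u \<theta>v - v \<theta>u\<close>, whose \<open>\<theta>\<close>-derivative is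
  \<open>(b - a + (d\<^sup>2 - c\<^sup>2) t\<^sup>2) u v\<close>; moreover \<open>d\<^sup>2 - c\<^sup>2 = (d - c) (d + c) = d - c\<close>.
\<close>

lemma by_parts_flux_diff: "by_parts_op flux_diff - fps_X * flux_diff = 2 * ((fps_const a - fps_const b) * fps_X\<^sup>2 - (fps_const d - fps_const c)) * product"
proof -
  define u v where "u = bessel_flux c f" and "v = bessel_flux d g"
  note D = derivs[folded u_def v_def]
  have flux_diff: "flux_diff = g * u - f * v" by (simp add: flux_diff_def u_def v_def)
  have "2 * (fps_X\<^sup>2 * fps_deriv flux_diff) = u * (2 * (fps_X\<^sup>2 * fps_deriv g)) + g * (2 * (fps_X\<^sup>2 * fps_deriv u))
     - v * (2 * (fps_X\<^sup>2 * fps_deriv f)) - f * (2 * (fps_X\<^sup>2 * fps_deriv v))"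
    unfolding flux_diff by (simp add: algebra_simps)
  also have "\<dots> = - 2 * flux_diff + 4 * ((fps_const a - fps_const b) * fps_X\<^sup>2 - (fps_const d - fps_const c)) * product"
    unfolding D flux_diff product_def using cd_fps
    by algebra
  finally have "2 * (by_parts_op flux_diff - fps_X * flux_diff) = 2 * (2 * ((fps_const a - fps_const b) * fps_X\<^sup>2 - (fps_const d - fps_const c)) * product)"
    by (simp add: by_parts_op_def algebra_simps)
  then show ?thesis by (metis mult_cancel_left zero_neq_numeral)
qed

text \<open>
  This is \<open>\<theta>\<^sup>2(u v) = (a + b) u v + 2 \<theta>u \<theta>v\<close>. The weight of \<open>flux_sum\<close> is \<open>e\<^sup>-\<^sup>t\<close>; compared with
  \<open>t\<^sup>-\<^sup>1 e\<^sup>-\<^sup>t\<close> it has a factor \<open>t\<close> more, whose derivative is the subtracted term.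
\<close>

lemma by_parts_flux_sum: "by_parts_op flux_sum - fps_X * flux_sum = flux_prod + 2 * (fps_const a + fps_const b) * fps_X\<^sup>2 * product"
proof -
  define u v where "u = bessel_flux c f" and "v = bessel_flux d g"
  note D = derivs[folded u_def v_def]
  have flux_sum: "flux_sum = f * v + g * u" by (simp add: flux_sum_def u_def v_def)
  have "2 * (fps_X\<^sup>2 * fps_deriv flux_sum) = u * (2 * (fps_X\<^sup>2 * fps_deriv g)) + g * (2 * (fps_X\<^sup>2 * fps_deriv u))
     + v * (2 * (fps_X\<^sup>2 * fps_deriv f)) + f * (2 * (fps_X\<^sup>2 * fps_deriv v))"
    unfolding flux_sum by (simp add: algebra_simps)
  also have "\<dots> = - 2 * flux_sum + 2 * flux_prod + 4 * (fps_const a + fps_const b) * fps_X\<^sup>2 * product"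
    unfolding D flux_sum product_def flux_prod_def u_def[symmetric] v_def[symmetric] using cd_fps
    by algebra
  finally have "2 * (by_parts_op flux_sum - fps_X * flux_sum) = 2 * (flux_prod + 2 * (fps_const a + fps_const b) * fps_X\<^sup>2 * product)"
    by (simp add: by_parts_op_def algebra_simps)
  then show ?thesis by (metis mult_cancel_left zero_neq_numeral)
qed

text \<open>
  This is \<open>\<theta>(\<theta>u \<theta>v) = (a + c\<^sup>2 t\<^sup>2) u \<theta>v + (b + d\<^sup>2 t\<^sup>2) v \<theta>u\<close>, split into its symmetric and its
  antisymmetric part. The weight is now \<open>t e\<^sup>-\<^sup>t\<close>, with two more factors \<open>t\<close> than \<open>t\<^sup>-\<^sup>1 e\<^sup>-\<^sup>t\<close>.
\<close>

lemma by_parts_flux_prod: "by_parts_op flux_prod - 2 * fps_X * flux_prod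
   = (fps_const a + fps_const b) * fps_X\<^sup>2 * flux_sum + ((fps_const b - fps_const a) * fps_X\<^sup>2 + (fps_const d - fps_const c)) * flux_diff"
proof -
  define u v where "u = bessel_flux c f" and "v = bessel_flux d g"
  note D = derivs[folded u_def v_def]
  have flux_prod: "flux_prod = u * v" by (simp add: flux_prod_def u_def v_def)
  have "2 * (fps_X\<^sup>2 * fps_deriv flux_prod) = v * (2 * (fps_X\<^sup>2 * fps_deriv u)) + u * (2 * (fps_X\<^sup>2 * fps_deriv v))"
    unfolding flux_prod by (simp add: algebra_simps)
  also have "\<dots> = 2 * (fps_X - 1) * flux_prod + 2 * ((fps_const a + fps_const b) * fps_X\<^sup>2 * flux_sum + ((fps_const b - fps_const a) * fps_X\<^sup>2 + (fps_const d - fps_const c)) * flux_diff)"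
    unfolding D flux_sum_def flux_diff_def flux_prod u_def[symmetric] v_def[symmetric] using cd_fps
    by algebra
  finally have "2 * (by_parts_op flux_prod - 2 * fps_X * flux_prod) = 2 * ((fps_const a + fps_const b) * fps_X\<^sup>2 * flux_sum + ((fps_const b - fps_const a) * fps_X\<^sup>2 + (fps_const d - fps_const c)) * flux_diff)"
    by (simp add: by_parts_op_def algebra_simps)
  then show ?thesis by (metis mult_cancel_left zero_neq_numeral)
qed

end

section \<open>The formal Mellin transform and the shift of the variable\<close>

text \<open>
  \<open>X / (1 + a X)\<close>, which is \<open>1 / (Z + a)\<close> for \<open>X = 1/Z\<close>. Spelling out the coefficients makes sense over every
  commutative ring and makes them invariant under ring homomorphisms.
\<close>

definition shift_X :: "int \<Rightarrow> 'a::comm_ring_1 fps" where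
  "shift_X a = Abs_fps (\<lambda>n. if n = 0 then 0 else (- of_int a) ^ (n - 1))"

text \<open>
  The substitution \<open>Z \<mapsto> Z + a\<close> on power series in \<open>X = 1/Z\<close>.
\<close>

definition shift :: "int \<Rightarrow> 'a::idom fps \<Rightarrow> 'a fps" where
  "shift a f = f oo shift_X a"

lemma shift_X_nth_0 [simp]: "fps_nth (shift_X a) 0 = 0"
  by (simp add: shift_X_def)

lemma shift_X_mult: "(1 + of_int a * fps_X) * shift_X a = (fps_X :: 'a::comm_ring_1 fps)"
proof (rule fps_ext)
  fix n
  show "fps_nth ((1 + of_int a * fps_X) * shift_X a) n = fps_nth (fps_X :: 'a fps) n"
    by (cases n; cases "n - 1") (auto simp: fps_of_int[symmetric] distrib_right mult.assoc shift_X_def)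
qed

lemma one_plus_X_nonzero [simp]: "1 + of_int a * fps_X \<noteq> (0 :: 'a::idom fps)"
proof
  assume "1 + of_int a * fps_X = (0 :: 'a fps)"
  then have "fps_nth (1 + of_int a * fps_X :: 'a fps) 0 = 0" by simp
  then show False by simp
qed

lemma shift_X_unique:
  assumes "(1 + of_int a * fps_X) * f = (fps_X :: 'a::idom fps)"
  shows "f = shift_X a"
  using assms shift_X_mult[of a] by (metis mult_left_cancel one_plus_X_nonzero)

lemma shift_add: "shift a (f + h) = shift a f + shift a h"
  and shift_diff: "shift a (f - h) = shift a f - shift a h"
  and shift_mult: "shift a (f * h) = shift a f * shift a h"
  and shift_minus: "shift a (- f) = - shift a f"
  and shift_power: "shift a (f ^ n) = shift a f ^ n"
  and shift_const [simp]: "shift a (fps_const u) = fps_const u"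
  and shift_1 [simp]: "shift a 1 = 1"
  and shift_numeral [simp]: "shift a (numeral k) = numeral k"
  and shift_fps_X [simp]: "shift a fps_X = shift_X a"
  by (simp_all add: shift_def fps_compose_add_distrib fps_compose_sub_distrib fps_compose_mult_distrib
      fps_compose_uminus fps_compose_power numeral_fps_const)

lemma shift_nth_0 [simp]: "fps_nth (shift a f) 0 = fps_nth f 0"
  by (simp add: shift_def)

lemma shift_shift_X: "shift a (shift_X b) = shift_X (a + b)"
proof (rule shift_X_unique)
  let ?X = "fps_X :: 'a fps" and ?S = "shift_X a :: 'a fps" and ?M = "shift a (shift_X b) :: 'a fps"
  have "shift a ((1 + of_int b * ?X) * shift_X b) = ?S"
    by (simp add: shift_X_mult)
  then have "(1 + of_int b * ?S) * ?M = ?S"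
    by (simp add: shift_add shift_mult flip: fps_of_int)
  then have "(1 + of_int a * ?X) * ((1 + of_int b * ?S) * ?M) = ?X"
    by (simp add: shift_X_mult)
  moreover have "(1 + of_int a * ?X) * (1 + of_int b * ?S) = 1 + of_int (a + b) * ?X"
    proof -
    have "(1 + of_int a * ?X) * (1 + of_int b * ?S) = 1 + of_int a * ?X + of_int b * ((1 + of_int a * ?X) * ?S)"
      by (simp add: algebra_simps)
    then show ?thesis
      unfolding shift_X_mult by (simp add: algebra_simps)
  qed
  ultimately show "(1 + of_int (a + b) * ?X) * ?M = ?X"
    by (metis mult.assoc)
qed

lemma shift_shift: "shift a (shift b f) = shift (a + b) f"
  unfolding shift_def using shift_shift_X[of a b, unfolded shift_def]
  by (metis fps_compose_assoc shift_X_nth_0)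

lemma shift_zero [simp]: "shift 0 f = f"
proof -
  have "shift_X 0 = (fps_X :: 'a fps)" using shift_X_mult[of 0, where 'a='a] by simp
  then show ?thesis by (simp add: shift_def)
qed

lemma inv_falling_mult: "inv_falling n * (\<Prod>j=1..n. 1 - of_nat j * fps_X) = fps_X ^ n"
  and inv_falling_denom_nth_0: "fps_nth (\<Prod>j=1..n. 1 - of_nat j * fps_X :: complex fps) 0 = 1"
proof -
  show 1: "fps_nth (\<Prod>j=1..n. 1 - of_nat j * fps_X :: complex fps) 0 = 1"
    by (induction n) simp_all
  show "inv_falling n * (\<Prod>j=1..n. 1 - of_nat j * fps_X) = fps_X ^ n"
    unfolding inv_falling_def using 1 
    by (subst fps_divide_unit) (auto simp: mult.assoc inverse_mult_eq_1)
qed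

lemma inv_falling_denom_nonzero: "(\<Prod>j=1..n. 1 - of_nat j * fps_X :: complex fps) \<noteq> 0"
  using inv_falling_denom_nth_0[of n] by (metis fps_zero_nth zero_neq_one)

lemma inv_falling_0 [simp]: "inv_falling 0 = 1"
  by (simp add: inv_falling_def)

lemma inv_falling_Suc: "inv_falling (Suc n) * (1 - of_nat (Suc n) * fps_X) = fps_X * inv_falling n"
proof -
  let ?d = "(\<Prod>j=1..n. 1 - of_nat j * fps_X :: complex fps)"
  have "inv_falling (Suc n) * (1 - of_nat (Suc n) * fps_X) * ?d = fps_X ^ Suc n"
    using inv_falling_mult[of "Suc n"] by (simp add: mult_ac)
  also have "\<dots> = fps_X * inv_falling n * ?d"
    using inv_falling_mult[of n] by (simp add: mult.assoc)
  finally show ?thesis by (rule mult_right_cancel[OF inv_falling_denom_nonzero, THEN iffD1])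
qed

text \<open>
  The recurrence of the Stirling numbers of the second kind, which are the coefficients of these series.
\<close>

lemma inv_falling_nth_Suc:
  "fps_nth (inv_falling (Suc n)) (Suc m) = of_nat (Suc n) * fps_nth (inv_falling (Suc n)) m + fps_nth (inv_falling n) m"
proof -
  have "inv_falling (Suc n) = fps_X * (fps_const (of_nat (Suc n)) * inv_falling (Suc n)) + fps_X * inv_falling n"
    using inv_falling_Suc[of n] unfolding fps_of_nat by (simp add: algebra_simps)
  then have "fps_nth (inv_falling (Suc n)) (Suc m) = fps_nth (fps_X * (fps_const (of_nat (Suc n)) * inv_falling (Suc n)) + fps_X * inv_falling n) (Suc m)"
    by simp
  then show ?thesis by (simp only: fps_add_nth fps_X_mult_nth fps_mult_left_const_nth) simp
qed

text \<open>
  \<open>1 / (Z (Z - 1) \<cdots> (Z - n)) = Z\<^sup>-\<^sup>1 \<cdot> 1 / ((Z - 1) \<cdots> (Z - n))\<close>.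
\<close>

lemma shift_inv_falling: "shift 1 (inv_falling (Suc n)) = fps_X * inv_falling n"
proof -
  let ?d = "\<lambda>n. (\<Prod>j=1..n. 1 - of_nat j * fps_X :: complex fps)"
  let ?S = "shift_X 1 :: complex fps"
  have S: "(1 + fps_X) * ?S = fps_X" using shift_X_mult[of 1, where 'a=complex] by simp
  have sd: "shift 1 (?d k) = (\<Prod>j=1..k. 1 - of_nat j * ?S)" for k
    by (induction k) (simp_all add: shift_mult shift_diff del: of_nat_Suc flip: fps_of_nat)
  have d: "(1 + fps_X) ^ Suc k * shift 1 (?d (Suc k)) = ?d k" for k
  proof (induction k)
    case 0
    show ?case unfolding sd using S by (simp add: algebra_simps)
  next
    case (Suc k)
    have "(1 + fps_X) ^ Suc (Suc k) * shift 1 (?d (Suc (Suc k)))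
        = ((1 + fps_X) ^ Suc k * shift 1 (?d (Suc k))) * ((1 + fps_X) * (1 - of_nat (Suc (Suc k)) * ?S))"
      unfolding sd by simp
    also have "(1 + fps_X) * (1 - of_nat (Suc (Suc k)) * ?S)
        = 1 + fps_X - of_nat (Suc (Suc k)) * ((1 + fps_X) * ?S)"
      by (simp add: algebra_simps)
    also have "\<dots> = 1 - of_nat (Suc k) * fps_X"
      unfolding S by (simp add: algebra_simps)
    finally show ?case unfolding Suc.IH by simp
  qed
  have "shift 1 (inv_falling (Suc n)) * ?d n
      = (1 + fps_X) ^ Suc n * shift 1 (inv_falling (Suc n) * ?d (Suc n))"
    unfolding d[of n, symmetric] shift_mult by (simp only: mult_ac)
  also have "\<dots> = ((1 + fps_X) * ?S) ^ Suc n"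
    unfolding inv_falling_mult shift_power power_mult_distrib by simp
  also have "\<dots> = fps_X * inv_falling n * ?d n"
    unfolding S mult.assoc inv_falling_mult by simp
  finally show ?thesis
    by (rule mult_right_cancel[OF inv_falling_denom_nonzero, THEN iffD1])
qed

text \<open>
  The formal version of \<open>h \<mapsto> \<Gamma>(Z)\<^sup>-\<^sup>1 \<integral> t\<^sup>Z\<^sup>-\<^sup>1 e\<^sup>-\<^sup>t h(1/t) dt\<close>, from series in \<open>1/t\<close> to series in \<open>1/Z\<close>.
\<close>

definition Mellin :: "complex poly poly fps \<Rightarrow> complex poly poly fps" where
  "Mellin h = Abs_fps (\<lambda>m. \<Sum>n\<le>m. fps_nth h n * const_AB (fps_nth (inv_falling n) m))"

lemma const_AB_hom: "const_AB 0 = 0" "const_AB 1 = 1" "const_AB (u + v) = const_AB u + const_AB v"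
  "const_AB (u * v) = const_AB u * const_AB v" "const_AB (u - v) = const_AB u - const_AB v" "const_AB (- u) = - const_AB u"
  by (simp_all add: const_AB_def one_pCons)

lemma const_AB_of_nat: "const_AB (of_nat n) = of_nat n"
  by (induction n) (simp_all add: const_AB_hom)

lemma const_AB_of_int: "const_AB (of_int n) = of_int n"
  by (cases n rule: int_cases2) (simp_all add: const_AB_hom const_AB_of_nat)

lemma const_AB_numeral: "const_AB (numeral n) = numeral n"
  using const_AB_of_nat[of "numeral n"] by simp

lemma const_AB_power: "const_AB (u ^ n) = const_AB u ^ n"
  by (induction n) (simp_all add: const_AB_hom)

lemma const_AB_sum: "const_AB (\<Sum>i\<in>I. u i) = (\<Sum>i\<in>I. const_AB (u i))"
  by (induction I rule: infinite_finite_induct) (simp_all add: const_AB_hom)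

lemma lift_fps_mult: "lift_fps (u * v) = lift_fps u * lift_fps v"
  by (rule fps_ext) (simp add: lift_fps_def fps_mult_nth const_AB_sum const_AB_hom)

lemma lift_fps_power: "lift_fps (u ^ n) = lift_fps u ^ n"
  by (induction n) (simp_all add: lift_fps_mult, simp add: lift_fps_def fps_eq_iff const_AB_hom)

lemma lift_fps_shift_X: "lift_fps (shift_X a) = shift_X a"
  by (rule fps_ext) (simp add: lift_fps_def shift_X_def const_AB_hom const_AB_power const_AB_of_int)

lemma Mellin_add: "Mellin (f + h) = Mellin f + Mellin h"
  and Mellin_diff: "Mellin (f - h) = Mellin f - Mellin h"
  and Mellin_const: "Mellin (fps_const u * f) = fps_const u * Mellin f"
  by (simp_all add: fps_eq_iff Mellin_def algebra_simps sum.distrib sum_subtractf sum_distrib_left)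

lemma Mellin_numeral: "Mellin (numeral k * f) = numeral k * Mellin f"
  by (simp add: numeral_fps_const Mellin_const)

text \<open>
  Integration by parts: \<open>\<integral> t\<^sup>Z (d/dt) k dt = - Z \<integral> t\<^sup>Z\<^sup>-\<^sup>1 k dt\<close> for \<open>k = t\<^sup>-\<^sup>1 e\<^sup>-\<^sup>t h(1/t)\<close>. On coefficients it
  is the recurrence of the Stirling numbers.
\<close>

lemma Mellin_by_parts: "fps_X * Mellin (by_parts_op h) = Mellin (fps_X * h)"
proof (rule fps_ext)
  fix m
  let ?e = "\<lambda>n m. const_AB (fps_nth (inv_falling n) m)"
  show "fps_nth (fps_X * Mellin (by_parts_op h)) m = fps_nth (Mellin (fps_X * h)) m"
  proof (cases m)
    case 0
    then show ?thesis by (simp add: Mellin_def)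
  next
    case (Suc k)
    have E: "fps_nth (by_parts_op h) n = fps_nth h n + of_nat n * (if n = 0 then 0 else fps_nth h (n - 1))" for n
    proof (cases "n < 2")
      case True
      then show ?thesis by (auto simp: by_parts_op_def fps_X_power_mult_nth less_2_cases_iff)
    next
      case False
      then obtain m where "n = m + 2" by (metis add.commute le_Suc_ex not_less)
      then show ?thesis by (simp add: by_parts_op_def fps_X_power_mult_nth distrib_right)
    qed
    have e0: "?e (Suc k) k = 0" by (simp add: inv_falling_nth_eq_0 const_AB_hom)
    have "fps_nth (Mellin (fps_X * h)) m = (\<Sum>n\<le>k. fps_nth h n * ?e (Suc n) (Suc k))"
      unfolding Suc by (simp add: Mellin_def sum.atMost_Suc_shift del: sum.atMost_Suc)
    also have "\<dots> = (\<Sum>n\<le>k. fps_nth h n * ?e n k) + (\<Sum>n\<le>k. of_nat (Suc n) * fps_nth h n * ?e (Suc n) k)"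
      by (simp add: inv_falling_nth_Suc const_AB_hom const_AB_of_nat algebra_simps sum.distrib)
    also have "(\<Sum>n\<le>k. of_nat (Suc n) * fps_nth h n * ?e (Suc n) k)
       = (\<Sum>n\<le>Suc k. of_nat n * (if n = 0 then 0 else fps_nth h (n - 1)) * ?e n k)"
      by (simp add: sum.atMost_Suc_shift del: sum.atMost_Suc of_nat_Suc)
    also have "\<dots> = (\<Sum>n\<le>k. of_nat n * (if n = 0 then 0 else fps_nth h (n - 1)) * ?e n k)"
      using e0 by simp
    also have "(\<Sum>n\<le>k. fps_nth h n * ?e n k) + \<dots> = fps_nth (fps_X * Mellin (by_parts_op h)) m"
      unfolding Suc by (simp add: Mellin_def E algebra_simps sum.distrib)
    finally show ?thesis by simp
  qed
qed

text \<open>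
  A factor \<open>1/t\<close> in the integrand is undone by \<open>Z \<mapsto> Z + 1\<close>; the factor \<open>X\<close> comes from \<open>\<Gamma>(Z + 1) = Z \<Gamma>(Z)\<close>.
\<close>

lemma shift_Mellin: "shift 1 (Mellin (fps_X * h)) = fps_X * Mellin h"
proof (rule fps_ext)
  fix m
  let ?e = "\<lambda>n m. fps_nth (inv_falling n) m"
  let ?s = "\<lambda>i. fps_nth (shift_X 1 ^ i) m :: complex"
  have s: "fps_nth (shift_X 1 ^ i) m = const_AB (?s i)" for i
    unfolding lift_fps_shift_X[symmetric] lift_fps_power[symmetric] by (simp add: lift_fps_def)
  have "fps_nth (shift 1 (Mellin (fps_X * h))) m
      = (\<Sum>i\<le>m. (\<Sum>n\<le>i. fps_nth (fps_X * h) n * const_AB (?e n i)) * const_AB (?s i))"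
    by (simp add: shift_def fps_compose_nth s Mellin_def atMost_atLeast0)
  also have "\<dots> = (\<Sum>i\<le>m. \<Sum>n\<le>m. fps_nth (fps_X * h) n * const_AB (?e n i * ?s i))"
    unfolding sum_distrib_right
    by (intro sum.cong refl sum.mono_neutral_cong_left)
       (auto simp: inv_falling_nth_eq_0 const_AB_hom mult.assoc)
  also have "\<dots> = (\<Sum>n\<le>m. fps_nth (fps_X * h) n * const_AB (\<Sum>i\<le>m. ?e n i * ?s i))"
    by (subst sum.swap) (simp add: sum_distrib_left const_AB_sum)
  also have "\<dots> = (\<Sum>n\<le>m. fps_nth (fps_X * h) n * const_AB (fps_nth (shift 1 (inv_falling n)) m))"
    by (simp add: shift_def fps_compose_nth atMost_atLeast0)
  also have "\<dots> = fps_nth (fps_X * Mellin h) m"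
  proof (cases m)
    case 0
    then show ?thesis by simp
  next
    case (Suc k)
    show ?thesis unfolding Suc
      by (simp add: sum.atMost_Suc_shift shift_inv_falling Mellin_def del: sum.atMost_Suc)
  qed
  finally show "fps_nth (shift 1 (Mellin (fps_X * h))) m = fps_nth (fps_X * Mellin h) m" .
qed

section \<open>Difference equations for the series over the polynomial ring\<close>

definition bessel_A :: "complex poly poly fps" where
  "bessel_A = Abs_fps (\<lambda>l. a_pol l varA * const_AB ((1 + \<i>) ^ l))"

definition bessel_B :: "complex poly poly fps" where
  "bessel_B = Abs_fps (\<lambda>l. a_pol l varB * const_AB ((1 - \<i>) ^ l))"

lemma a_pol_rec:
  assumes "c * p = 1"
  shows "8 * const_AB c * of_nat (Suc n) * (a_pol (Suc n) x * const_AB (p ^ Suc n))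
    = (4 * x - (2 * of_nat n + 1)\<^sup>2) * (a_pol n x * const_AB (p ^ n))"
proof -
  have "8 * c * of_nat (Suc n) * (1 / (8 ^ Suc n * fact (Suc n))) * p ^ Suc n = c * p * (1 / (8 ^ n * fact n)) * p ^ n"
    by (simp add: field_simps del: of_nat_Suc)
  also have "\<dots> = 1 / (8 ^ n * fact n) * p ^ n"
    using assms by simp
  finally have "const_AB (8 * c * of_nat (Suc n) * (1 / (8 ^ Suc n * fact (Suc n))) * p ^ Suc n)
      = const_AB (1 / (8 ^ n * fact n) * p ^ n)"
    by (rule arg_cong)
  then have "8 * const_AB c * of_nat (Suc n) * const_AB (1 / (8 ^ Suc n * fact (Suc n))) * const_AB (p ^ Suc n)
      = const_AB (1 / (8 ^ n * fact n)) * const_AB (p ^ n)"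
    by (simp only: const_AB_hom const_AB_of_nat const_AB_numeral)
  moreover have "a_pol (Suc n) x = const_AB (1 / (8 ^ Suc n * fact (Suc n)))
      * ((\<Prod>j<n. 4 * x - (2 * of_nat j + 1)\<^sup>2) * (4 * x - (2 * of_nat n + 1)\<^sup>2))"
    unfolding a_pol_def by simp
  ultimately show ?thesis
    unfolding a_pol_def[of n] by algebra
qed

interpretation bessel: bessel_product "const_AB ((1 - \<i>) / 2)" "const_AB ((1 + \<i>) / 2)" varA varB bessel_A bessel_B
proof
  show "const_AB ((1 - \<i>) / 2) + const_AB ((1 + \<i>) / 2) = 1"
    by (simp flip: const_AB_hom add: field_simps)
  show "(const_AB ((1 - \<i>) / 2))\<^sup>2 + (const_AB ((1 + \<i>) / 2))\<^sup>2 = 0"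
    by (simp flip: const_AB_hom const_AB_power add: power2_eq_square field_simps)
  show "8 * const_AB ((1 - \<i>) / 2) * of_nat (Suc n) * fps_nth bessel_A (Suc n)
      = (4 * varA - (2 * of_nat n + 1)\<^sup>2) * fps_nth bessel_A n" for n
    unfolding bessel_A_def fps_nth_Abs_fps by (rule a_pol_rec) (simp add: field_simps)
  show "8 * const_AB ((1 + \<i>) / 2) * of_nat (Suc n) * fps_nth bessel_B (Suc n)
      = (4 * varB - (2 * of_nat n + 1)\<^sup>2) * fps_nth bessel_B n" for n
    unfolding bessel_B_def fps_nth_Abs_fps by (rule a_pol_rec) (simp add: field_simps)
qed

lemma F_eq_Mellin: "F = Mellin bessel.product"
proof -
  have "fps_nth bessel.product n = G n" for n
    unfolding bessel.product_def fps_mult_nth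
    by (simp add: bessel_A_def bessel_B_def G_def const_AB_hom atLeast0AtMost mult_ac)
  then show ?thesis
    by (simp add: F_def Mellin_def lift_fps_def fps_eq_iff)
qed

text \<open>
  The Mellin transform of \<open>u \<theta>v - v \<theta>u\<close>, up to the factor \<open>2\<close>. The shift aligns it with \<open>F\<close>: the flux
  difference lacks the factor \<open>1/t\<close> in the weight of \<open>u v\<close>.
\<close>

definition flux_series :: "complex poly poly fps" where "flux_series = shift 1 (Mellin bessel.flux_diff)"

abbreviation "i_AB \<equiv> fps_const (const_AB \<i>)"

lemma diff_const: "fps_const (const_AB ((1 + \<i>) / 2)) - fps_const (const_AB ((1 - \<i>) / 2)) = i_AB"
  by (simp flip: const_AB_hom add: field_simps)

lemma shift_Mellin_2: "shift 2 (Mellin (fps_X * (fps_X * h))) = shift_X 1 * (fps_X * Mellin h)"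
  using shift_shift[of 1 1 "Mellin (fps_X * (fps_X * h))"]
  by (simp add: shift_Mellin shift_mult)

lemma shift_Mellin_3: "shift 3 (Mellin (fps_X * (fps_X * (fps_X * h)))) = shift_X 2 * (shift_X 1 * (fps_X * Mellin h))"
  using shift_shift[of 2 1 "Mellin (fps_X * (fps_X * (fps_X * h)))"]
  by (simp add: shift_Mellin shift_mult shift_Mellin_2)

text \<open>
  Transform of the equation for \<open>flux_diff\<close>. Shifting by \<open>2\<close> turns the Mellin transforms of
  \<open>y flux_diff\<close> and \<open>y\<^sup>2 product\<close> into multiples of \<open>flux_series\<close> and \<open>F\<close>; what remains is to clear the
  denominators \<open>Z + 1\<close> and \<open>Z + 2\<close>.
\<close>

lemma flux_series_eq: "(1 + fps_X) * flux_series
   = 2 * (fps_const (varA - varB) * fps_X\<^sup>2 * F - i_AB * (1 + fps_X) * shift 2 F)"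
proof -
  define AB where "AB = fps_const varA - fps_const varB"
  have *: "Mellin (by_parts_op bessel.flux_diff) - Mellin (fps_X * bessel.flux_diff) = 2 * (AB * Mellin (fps_X * (fps_X * bessel.product)) - i_AB * F)"
    unfolding Mellin_diff[symmetric] bessel.by_parts_flux_diff diff_const F_eq_Mellin
    by (simp add: left_diff_distrib right_diff_distrib Mellin_numeral Mellin_const Mellin_diff mult.assoc power2_eq_square AB_def del: fps_const_sub)
  have "Mellin (fps_X * bessel.flux_diff) - fps_X * Mellin (fps_X * bessel.flux_diff)
     = fps_X * (2 * (AB * Mellin (fps_X * (fps_X * bessel.product)) - i_AB * F))"
    unfolding *[symmetric] using Mellin_by_parts[of bessel.flux_diff] by (simp add: algebra_simps)
  then have "shift 2 (Mellin (fps_X * bessel.flux_diff) - fps_X * Mellin (fps_X * bessel.flux_diff))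
     = shift 2 (fps_X * (2 * (AB * Mellin (fps_X * (fps_X * bessel.product)) - i_AB * F)))"
    by simp
  moreover have "shift 2 (Mellin (fps_X * bessel.flux_diff)) = shift_X 1 * flux_series"
    using shift_shift[of 1 1 "Mellin (fps_X * bessel.flux_diff)"] by (simp add: flux_series_def shift_Mellin shift_mult)
  moreover have "shift 2 AB = AB" by (simp add: AB_def)
  ultimately have **: "shift_X 1 * flux_series - shift_X 2 * (shift_X 1 * flux_series)
     = shift_X 2 * (2 * (AB * (shift_X 1 * (fps_X * F)) - i_AB * shift 2 F))"
    unfolding shift_diff shift_mult shift_Mellin_2 F_eq_Mellin by simp
  define s1 s2 :: "complex poly poly fps" where "s1 = shift_X 1" and "s2 = shift_X 2"
  have s: "(1 + fps_X) * s1 = fps_X" "(1 + 2 * fps_X) * s2 = fps_X"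
    using shift_X_mult[of 1, where 'a = "complex poly poly"] shift_X_mult[of 2, where 'a = "complex poly poly"]
    by (simp_all add: s1_def s2_def)
  define U where "U = s1 * (fps_X * F)"
  have U: "(1 + fps_X) * U = fps_X\<^sup>2 * F"
    unfolding U_def mult.assoc[symmetric] s(1) by (simp add: power2_eq_square)
  define V where "V = 2 * (AB * U - i_AB * shift 2 F)"
  have a: "(1 + 2 * fps_X) * (1 - s2) = 1 + fps_X"
    using s(2) by (simp add: algebra_simps)
  have "(1 - s2) * (s1 * flux_series) = s2 * V"
    unfolding left_diff_distrib mult_1_left
    by (rule **[folded s1_def s2_def, folded U_def, folded V_def])
  then have "(1 + 2 * fps_X) * ((1 - s2) * (s1 * flux_series)) = (1 + 2 * fps_X) * (s2 * V)"
    by (rule arg_cong)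
  then have "fps_X * flux_series = fps_X * V"
    unfolding mult.assoc[symmetric] a s .
  then have "flux_series = V" by simp
  have "(1 + fps_X) * flux_series = 2 * (AB * ((1 + fps_X) * U) - i_AB * (1 + fps_X) * shift 2 F)"
    unfolding \<open>flux_series = V\<close> V_def by (simp add: algebra_simps)
  then have "(1 + fps_X) * flux_series = 2 * (AB * fps_X\<^sup>2 * F - i_AB * (1 + fps_X) * shift 2 F)"
    unfolding U by (simp add: mult.assoc)
  then show ?thesis by (simp add: AB_def)
qed

text \<open>
  Transform of the third-order equation
  \<open>\<theta>\<^sup>3(u v) - 2 (a + b) \<theta>(u v) = ((a - b) - i t\<^sup>2) (u \<theta>v - v \<theta>u)\<close>, obtained by eliminating \<open>flux_sum\<close> and
  \<open>flux_prod\<close>. Clearing the positive powers of \<open>t\<close> multiplies \<open>u v\<close> by \<open>y\<^sup>3\<close>, and a shift by \<open>3\<close> brings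
  back \<open>F\<close>.
\<close>

lemma F_eq_flux_series: "2 * (1 + fps_X) ^ 3 * F - 4 * fps_const (varA + varB) * fps_X\<^sup>2 * (1 + fps_X) * F
   = i_AB * (1 + fps_X) * (1 + 2 * fps_X) * shift 2 flux_series - fps_const (varA - varB) * fps_X\<^sup>2 * flux_series"
proof -
  define AB where "AB = fps_const varA - fps_const varB"
  define ApB where "ApB = fps_const varA + fps_const varB"
  define T3 where "T3 = Mellin (fps_X * (fps_X * (fps_X * bessel.product)))"
  define WX where "WX = Mellin (fps_X * (fps_X * bessel.flux_diff))"
  have e2: "fps_X * (by_parts_op h - fps_X * h) = by_parts_op (fps_X * h) - 2 * fps_X * (fps_X * h)" for h :: "complex poly poly fps"
    by (simp add: by_parts_op_def power2_eq_square algebra_simps)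
  have parts2: "fps_X * Mellin (by_parts_op h - 2 * fps_X * h) = (1 - 2 * fps_X) * Mellin (fps_X * h)" for h
    unfolding Mellin_diff right_diff_distrib Mellin_by_parts left_diff_distrib mult.assoc Mellin_numeral
    by (simp add: mult.left_commute)
  have Q: "(1 - 2 * fps_X) * Mellin (fps_X * bessel.flux_prod)
      = fps_X * (ApB * Mellin (fps_X * (fps_X * bessel.flux_sum)) - AB * WX + i_AB * Mellin bessel.flux_diff)"
    unfolding parts2[symmetric] bessel.by_parts_flux_prod diff_const
    by (simp add: distrib_right left_diff_distrib Mellin_numeral Mellin_const Mellin_diff Mellin_add mult.assoc power2_eq_square ApB_def AB_def WX_def del: fps_const_sub fps_const_add)
  have "fps_X * bessel.flux_prod = by_parts_op (fps_X * bessel.flux_sum) - 2 * fps_X * (fps_X * bessel.flux_sum) - 2 * (fps_const varA + fps_const varB) * fps_X ^ 3 * bessel.product"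
    using e2[of bessel.flux_sum] unfolding bessel.by_parts_flux_sum by (simp add: algebra_simps power3_eq_cube power2_eq_square)
  then have S: "fps_X * Mellin (fps_X * bessel.flux_prod) = (1 - 2 * fps_X) * Mellin (fps_X * (fps_X * bessel.flux_sum)) - 2 * fps_X * ApB * T3"
    using parts2[of "fps_X * bessel.flux_sum"]
    by (simp add: distrib_right distrib_left right_diff_distrib Mellin_numeral Mellin_const Mellin_diff Mellin_add mult.assoc power3_eq_cube T3_def ApB_def del: fps_const_sub fps_const_add)
  have P: "fps_X * Mellin (fps_X * (fps_X * bessel.flux_sum)) = 2 * (1 - 2 * fps_X) * T3"
  proof -
    have "fps_X * (fps_X * by_parts_op bessel.product) = by_parts_op (fps_X * (fps_X * bessel.product)) - 2 * fps_X * (fps_X * (fps_X * bessel.product))"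
      by (simp add: by_parts_op_def power2_eq_square algebra_simps)
    then have E: "fps_X * Mellin (fps_X * (fps_X * by_parts_op bessel.product)) = (1 - 2 * fps_X) * T3"
      unfolding T3_def parts2[symmetric] by simp
    have SE: "fps_X * (fps_X * bessel.flux_sum) = 2 * (fps_X * (fps_X * by_parts_op bessel.product))"
      unfolding bessel.flux_sum_eq by (simp only: mult_ac)
    have "fps_X * Mellin (fps_X * (fps_X * bessel.flux_sum)) = 2 * (fps_X * Mellin (fps_X * (fps_X * by_parts_op bessel.product)))"
      unfolding SE Mellin_numeral by (rule mult.left_commute)
    then show ?thesis
      by (simp only: E mult.assoc)
  qed
  have "2 * (1 - 2 * fps_X) ^ 3 * T3 - 4 * ApB * fps_X\<^sup>2 * (1 - 2 * fps_X) * T3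
      = fps_X ^ 3 * (i_AB * Mellin bessel.flux_diff - AB * WX)"
  proof -
    define SX where "SX = Mellin (fps_X * (fps_X * bessel.flux_sum))"
    have "fps_X ^ 3 * (i_AB * Mellin bessel.flux_diff - AB * WX)
        = fps_X\<^sup>2 * ((1 - 2 * fps_X) * Mellin (fps_X * bessel.flux_prod)) - fps_X\<^sup>2 * ApB * (fps_X * SX)"
      unfolding Q SX_def by (simp add: algebra_simps power2_eq_square power3_eq_cube)
    also have "\<dots> = fps_X * (1 - 2 * fps_X) * (fps_X * Mellin (fps_X * bessel.flux_prod)) - fps_X\<^sup>2 * ApB * (fps_X * SX)"
      by (simp add: mult_ac power2_eq_square)
    also have "\<dots> = (1 - 2 * fps_X)\<^sup>2 * (fps_X * SX) - 2 * fps_X\<^sup>2 * (1 - 2 * fps_X) * ApB * T3 - fps_X\<^sup>2 * ApB * (fps_X * SX)"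
      unfolding S SX_def[symmetric] by (simp add: algebra_simps power2_eq_square)
    also have "\<dots> = 2 * (1 - 2 * fps_X) ^ 3 * T3 - 4 * ApB * fps_X\<^sup>2 * (1 - 2 * fps_X) * T3"
      unfolding P[folded SX_def] by (simp add: algebra_simps power2_eq_square power3_eq_cube)
    finally show ?thesis by simp
  qed
  then have "shift 3 (2 * (1 - 2 * fps_X) ^ 3 * T3 - 4 * ApB * fps_X\<^sup>2 * (1 - 2 * fps_X) * T3)
      = shift 3 (fps_X ^ 3 * (i_AB * Mellin bessel.flux_diff - AB * WX))" by simp
  moreover have "shift 3 T3 = shift_X 2 * (shift_X 1 * (fps_X * F))"
    by (simp add: T3_def shift_Mellin_3 F_eq_Mellin)
  moreover have "shift 3 (Mellin bessel.flux_diff) = shift 2 flux_series"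
    by (simp add: flux_series_def shift_shift)
  moreover have "shift 3 WX = shift_X 2 * (shift_X 1 * flux_series)"
    using shift_shift[of 1 2 WX] unfolding WX_def shift_Mellin_2
    by (simp add: flux_series_def shift_mult shift_shift_X)
  moreover have "shift 3 AB = AB" "shift 3 ApB = ApB" by (simp_all add: AB_def ApB_def)
  ultimately have **: "2 * (1 - 2 * shift_X 3) ^ 3 * (shift_X 2 * (shift_X 1 * (fps_X * F)))
       - 4 * ApB * (shift_X 3)\<^sup>2 * (1 - 2 * shift_X 3) * (shift_X 2 * (shift_X 1 * (fps_X * F)))
     = (shift_X 3) ^ 3 * (i_AB * shift 2 flux_series - AB * (shift_X 2 * (shift_X 1 * flux_series)))"
    by (simp add: shift_diff shift_mult shift_power)
  define s1 s2 s3 :: "complex poly poly fps" where "s1 = shift_X 1" and "s2 = shift_X 2" and "s3 = shift_X 3"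
  have s: "(1 + fps_X) * s1 = fps_X" "(1 + 2 * fps_X) * s2 = fps_X" "(1 + 3 * fps_X) * s3 = fps_X"
    using shift_X_mult[of 1, where 'a = "complex poly poly"] shift_X_mult[of 2, where 'a = "complex poly poly"] shift_X_mult[of 3, where 'a = "complex poly poly"]
    by (simp_all add: s1_def s2_def s3_def)
  define X :: "complex poly poly fps" where "X = fps_X"
  define R where "R = shift 2 flux_series"
  define U where "U = s2 * (s1 * (X * F))"
  define V where "V = s2 * (s1 * flux_series)"
  have "(1 + X) * (1 + 2 * X) * U = ((1 + X) * s1) * ((1 + 2 * X) * s2) * (X * F)"
    "(1 + X) * (1 + 2 * X) * V = ((1 + X) * s1) * ((1 + 2 * X) * s2) * flux_series"
    by (simp_all only: U_def V_def mult_ac)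
  then have UV: "(1 + X) * (1 + 2 * X) * U = X ^ 3 * F" "(1 + X) * (1 + 2 * X) * V = X ^ 2 * flux_series"
    unfolding s[folded X_def] by (simp_all add: power2_eq_square power3_eq_cube)
  have "(1 + 3 * X) * (1 - 2 * s3) = 1 + 3 * X - 2 * ((1 + 3 * X) * s3)"
    by (simp add: algebra_simps)
  then have u: "(1 + 3 * X) * (1 - 2 * s3) = 1 + X"
    unfolding s(3)[folded X_def] by simp
  have gen: "a ^ 3 * (2 * b ^ 3 * U - 4 * ApB * t\<^sup>2 * b * U) = 2 * (a * b) ^ 3 * U - 4 * ApB * (a * t)\<^sup>2 * (a * b) * U"
    for a b t :: "complex poly poly fps"
    by (simp add: algebra_simps power2_eq_square power3_eq_cube)
  have "2 * ((1 + 3 * X) * (1 - 2 * s3)) ^ 3 * U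
       - 4 * ApB * ((1 + 3 * X) * s3)\<^sup>2 * ((1 + 3 * X) * (1 - 2 * s3)) * U
     = ((1 + 3 * X) * s3) ^ 3 * (i_AB * R - AB * V)"
    using **[folded s1_def s2_def s3_def X_def R_def, folded U_def V_def]
    unfolding gen[symmetric] by (simp only: power_mult_distrib mult.assoc)
  then have "2 * (1 + X) ^ 3 * U - 4 * ApB * X\<^sup>2 * (1 + X) * U = X ^ 3 * (i_AB * R - AB * V)"
    unfolding u s(3)[folded X_def] .
  then have "X ^ 3 * (2 * (1 + X) ^ 3 * F - 4 * ApB * X\<^sup>2 * (1 + X) * F)
      = X ^ 3 * (i_AB * (1 + X) * (1 + 2 * X) * R - AB * X\<^sup>2 * flux_series)"
  proof -
    assume *: "2 * (1 + X) ^ 3 * U - 4 * ApB * X\<^sup>2 * (1 + X) * U = X ^ 3 * (i_AB * R - AB * V)"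
    have "X ^ 3 * (2 * (1 + X) ^ 3 * F - 4 * ApB * X\<^sup>2 * (1 + X) * F)
        = (2 * (1 + X) ^ 3 - 4 * ApB * X\<^sup>2 * (1 + X)) * (X ^ 3 * F)"
      by (simp only: left_diff_distrib right_diff_distrib mult_ac)
    also have "\<dots> = ((1 + X) * (1 + 2 * X)) * (2 * (1 + X) ^ 3 * U - 4 * ApB * X\<^sup>2 * (1 + X) * U)"
      unfolding UV(1)[symmetric] by (simp only: left_diff_distrib right_diff_distrib mult_ac)
    also have "\<dots> = X ^ 3 * (i_AB * ((1 + X) * (1 + 2 * X) * R) - AB * ((1 + X) * (1 + 2 * X) * V))"
      unfolding * by (simp only: left_diff_distrib right_diff_distrib mult_ac)
    finally show ?thesis
      unfolding UV(2) by (simp only: mult.assoc)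
  qed
  then have "2 * (1 + X) ^ 3 * F - 4 * ApB * X\<^sup>2 * (1 + X) * F
      = i_AB * (1 + X) * (1 + 2 * X) * R - AB * X\<^sup>2 * flux_series"
    by (simp add: X_def)
  then show ?thesis by (simp add: X_def R_def AB_def ApB_def)
qed

section \<open>First-order expansion at the origin\<close>

definition eval0 :: "complex poly poly \<Rightarrow> complex" where
  "eval0 p = poly (poly p 0) 0"

text \<open>
  The derivative at the origin in the direction \<open>(u, v)\<close> of the \<open>(A, B)\<close>-plane.
\<close>

definition dir_deriv :: "complex \<Rightarrow> complex \<Rightarrow> complex poly poly \<Rightarrow> complex" where
  "dir_deriv u v p = u * poly (poly (pderiv p) 0) 0 + v * poly (pderiv (poly p 0)) 0"

lemma eval0_simps [simp]:
  "eval0 (p + q) = eval0 p + eval0 q" "eval0 (p - q) = eval0 p - eval0 q" "eval0 (- p) = - eval0 p"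
  "eval0 (p * q) = eval0 p * eval0 q" "eval0 (const_AB c) = c" "eval0 0 = 0" "eval0 1 = 1"
  "eval0 (numeral k) = numeral k" "eval0 (of_nat n) = of_nat n" "eval0 varA = 0" "eval0 varB = 0"
  "eval0 (p ^ n) = eval0 p ^ n" "eval0 (sum h I) = (\<Sum>i\<in>I. eval0 (h i))"
  by (simp_all add: eval0_def const_AB_def varA_def varB_def poly_sum)

lemma dir_deriv_simps [simp]:
  "dir_deriv u v (p + q) = dir_deriv u v p + dir_deriv u v q" "dir_deriv u v (p - q) = dir_deriv u v p - dir_deriv u v q" "dir_deriv u v (- p) = - dir_deriv u v p"
  "dir_deriv u v (p * q) = dir_deriv u v p * eval0 q + eval0 p * dir_deriv u v q" "dir_deriv u v (const_AB c) = 0" "dir_deriv u v 0 = 0" "dir_deriv u v 1 = 0"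
  "dir_deriv u v varA = u" "dir_deriv u v varB = v"
  by (simp_all add: dir_deriv_def eval0_def const_AB_def varA_def varB_def pderiv_add pderiv_diff pderiv_minus
      pderiv_mult pderiv_pCons pderiv_1 algebra_simps)

lemma dir_deriv_of_nat [simp]: "dir_deriv u v (of_nat n) = 0"
  by (metis const_AB_of_nat dir_deriv_simps(5))

lemma dir_deriv_numeral [simp]: "dir_deriv u v (numeral n) = 0"
  by (metis const_AB_numeral dir_deriv_simps(5))

lemma dir_deriv_sum [simp]: "dir_deriv u v (sum h I) = (\<Sum>i\<in>I. dir_deriv u v (h i))"
  by (induction I rule: infinite_finite_induct) simp_all

lemma dir_deriv_add: "dir_deriv u v p + dir_deriv u' v' p = dir_deriv (u + u') (v + v') p"
  by (simp add: dir_deriv_def algebra_simps)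

definition eval0_fps :: "complex poly poly fps \<Rightarrow> complex fps" where
  "eval0_fps f = Abs_fps (\<lambda>n. eval0 (fps_nth f n))"

definition dir_fps :: "complex \<Rightarrow> complex \<Rightarrow> complex poly poly fps \<Rightarrow> complex fps" where
  "dir_fps u v f = Abs_fps (\<lambda>n. dir_deriv u v (fps_nth f n))"

lemma eval0_fps_simps [simp]:
  "eval0_fps (f + h) = eval0_fps f + eval0_fps h" "eval0_fps (f - h) = eval0_fps f - eval0_fps h"
  "eval0_fps (f * h) = eval0_fps f * eval0_fps h" "eval0_fps (fps_const p) = fps_const (eval0 p)"
  "eval0_fps fps_X = fps_X" "eval0_fps 1 = 1" "eval0_fps (fps_deriv f) = fps_deriv (eval0_fps f)"
  by (auto simp: fps_eq_iff eval0_fps_def fps_mult_nth)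

lemma eval0_fps_numeral [simp]: "eval0_fps (numeral k) = numeral k"
  by (simp add: numeral_fps_const)

lemma eval0_fps_power [simp]: "eval0_fps (f ^ n) = eval0_fps f ^ n"
  by (induction n) simp_all

lemma dir_fps_simps [simp]:
  "dir_fps u v (f + h) = dir_fps u v f + dir_fps u v h" "dir_fps u v (f - h) = dir_fps u v f - dir_fps u v h"
  "dir_fps u v (f * h) = dir_fps u v f * eval0_fps h + eval0_fps f * dir_fps u v h"
  "dir_fps u v (fps_const p) = fps_const (dir_deriv u v p)"
  "dir_fps u v fps_X = 0" "dir_fps u v 1 = 0" "dir_fps u v (fps_deriv f) = fps_deriv (dir_fps u v f)"
  by (auto simp: fps_eq_iff dir_fps_def eval0_fps_def fps_mult_nth sum.distrib)

lemma dir_fps_numeral [simp]: "dir_fps u v (numeral k) = 0"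
  by (simp add: numeral_fps_const)

lemma dir_fps_1_plus_X_power [simp]: "dir_fps u v ((1 + fps_X) ^ n) = 0"
  by (induction n) simp_all

text \<open>
  The left-hand side is over the polynomial ring and the right-hand side over \<open>\<complex>\<close>; so evaluation and
  differentiation at the origin commute with the shift.
\<close>

lemma shift_X_power_nth: "fps_nth (shift_X a ^ i) n = const_AB (fps_nth (shift_X a ^ i) n)"
  unfolding lift_fps_shift_X[symmetric] lift_fps_power[symmetric] by (simp add: lift_fps_def)

lemma eval0_fps_shift [simp]: "eval0_fps (shift a f) = shift a (eval0_fps f)"
  unfolding fps_eq_iff shift_def
  by (simp add: eval0_fps_def fps_compose_nth shift_X_power_nth)

lemma dir_fps_shift [simp]: "dir_fps u v (shift a f) = shift a (dir_fps u v f)"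
  unfolding fps_eq_iff shift_def
  by (simp add: dir_fps_def fps_compose_nth shift_X_power_nth)

lemma F_nth_0: "fps_nth F 0 = 1"
  by (simp add: F_def G_def lift_fps_def a_pol_def const_AB_hom)

definition "F0 = eval0_fps F"
definition "F1 u v = dir_fps u v F"

lemma F0_nth_0 [simp]: "fps_nth F0 0 = 1"
  by (simp add: F0_def eval0_fps_def F_nth_0)

lemma F0_nonzero [simp]: "F0 \<noteq> 0"
  using F0_nth_0 by (metis fps_zero_nth zero_neq_one)

lemma F1_nth_0 [simp]: "fps_nth (F1 u v) 0 = 0"
  by (simp add: F1_def dir_fps_def F_nth_0)

lemma lift_fps_deriv: "lift_fps (fps_deriv u) = fps_deriv (lift_fps u)"
  by (simp add: fps_eq_iff lift_fps_def const_AB_hom const_AB_of_nat flip: of_nat_Suc)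

definition "log_F = lift_fps (fps_ln 1) oo (F - 1)"

text \<open>
  The equation \<open>(log F)' F = F'\<close> in the variable \<open>X\<close> characterises the logarithm. Differentiating it
  in \<open>A\<close> avoids a chain rule for composition.
\<close>

lemma log_F_deriv: "fps_deriv log_F * F = fps_deriv F"
proof -
  let ?l = "lift_fps (inverse (1 + fps_X))"
  have "inverse (1 + fps_X) * (1 + fps_X) = (1 :: complex fps)"
    by (rule inverse_mult_eq_1) simp
  then have "?l * lift_fps (1 + fps_X) = lift_fps 1"
    by (metis lift_fps_mult)
  moreover have "lift_fps (1 + fps_X) = 1 + fps_X" "lift_fps 1 = 1"
    by (auto simp: lift_fps_def fps_eq_iff const_AB_hom)
  ultimately have "?l * (1 + fps_X) = 1"
    by simp
  then have "(?l oo (F - 1)) * ((1 + fps_X) oo (F - 1)) = 1"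
    by (subst fps_compose_mult_distrib[symmetric]) (simp_all add: F_nth_0)
  then have "(?l oo (F - 1)) * F = 1"
    by (simp add: fps_compose_add_distrib F_nth_0)
  moreover have "fps_deriv log_F = (?l oo (F - 1)) * fps_deriv F"
    unfolding log_F_def by (subst fps_compose_deriv) (simp_all add: F_nth_0 fps_ln_deriv flip: lift_fps_deriv)
  ultimately show ?thesis by (simp add: mult_ac)
qed

definition "g_fps = Abs_fps g"

text \<open>
  \<open>\<partial>\<^sub>A log F = \<partial>\<^sub>A F / F\<close> at the origin: both sides vanish at \<open>X = 0\<close> and have the same derivative in \<open>X\<close>.
\<close>

lemma g_fps_eq: "g_fps * F0 = F1 1 0"
proof -
  have log0: "fps_nth log_F 0 = 0"
    by (simp add: log_F_def lift_fps_def const_AB_hom)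
  have g: "g_fps = dir_fps 1 0 log_F"
    by (simp add: g_fps_def fps_eq_iff dir_fps_def g_def L_def log_F_def dir_deriv_def)
  define q where "q = F1 1 0 * inverse F0"
  have q: "F1 1 0 = q * F0"
    unfolding q_def mult.assoc by (simp add: inverse_mult_eq_1)
  have "fps_deriv (dir_fps 1 0 log_F) * F0 + fps_deriv (eval0_fps log_F) * (q * F0) = fps_deriv (q * F0)"
    using arg_cong[OF log_F_deriv, of "dir_fps 1 0"] unfolding q[symmetric] by (simp add: F0_def F1_def)
  moreover have e: "fps_deriv (eval0_fps log_F) * F0 = fps_deriv F0"
    using arg_cong[OF log_F_deriv, of eval0_fps] by (simp add: F0_def)
  moreover have "fps_deriv (eval0_fps log_F) * (q * F0) = q * fps_deriv F0"
    unfolding e[symmetric] by (simp only: mult_ac)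
  ultimately have "fps_deriv (dir_fps 1 0 log_F) * F0 = fps_deriv q * F0"
    by simp
  then have "fps_deriv (dir_fps 1 0 log_F) = fps_deriv q" by simp
  moreover have "fps_nth q 0 = 0" by (simp add: q_def)
  moreover have "fps_nth (dir_fps 1 0 log_F) 0 = 0" by (simp add: dir_fps_def log0)
  ultimately have "dir_fps 1 0 log_F = q"
    by (metis fps_deriv_eq_iff add_0 fps_const_0_eq_0)
  then show ?thesis by (simp add: g q)
qed

lemma a_pol_Suc: "a_pol (Suc n) x = const_AB (1 / (8 * (of_nat n + 1))) * (4 * x - (2 * of_nat n + 1)\<^sup>2) * a_pol n x"
proof -
  have "const_AB (1 / (8 ^ Suc n * fact (Suc n))) = const_AB (1 / (8 * (of_nat n + 1))) * const_AB (1 / (8 ^ n * fact n))"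
    by (simp add: field_simps flip: const_AB_hom)
  then show ?thesis by (simp add: a_pol_def mult_ac)
qed

text \<open>
  The values are real, but the form stated here, where conjugation exchanges \<open>A\<close> and \<open>B\<close>, is the one that
  passes to \<open>G\<close>, since \<open>q\<close> is the conjugate of \<open>p\<close>.
\<close>

lemma a_pol_cnj:
  assumes "u \<in> \<real>" "v \<in> \<real>"
  shows "cnj (eval0 (a_pol n varA)) = eval0 (a_pol n varB)" (is "?P n")
    and "cnj (dir_deriv u v (a_pol n varA)) = dir_deriv v u (a_pol n varB)" (is "?Q n")
proof -
  have "cnj u = u" "cnj v = v" using assms by (simp_all add: Reals_cnj_iff)
  then have "?P n \<and> ?Q n"
    by (induction n) (simp_all add: a_pol_Suc power2_eq_square, simp add: a_pol_def const_AB_hom)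
  then show "?P n" "?Q n" by auto
qed

lemma G_cnj:
  assumes "u \<in> \<real>" "v \<in> \<real>"
  shows "cnj (eval0 (G n)) = eval0 (G n)"
    and "cnj (dir_deriv u v (G n)) = dir_deriv v u (G n)"
proof -
  have BA: "cnj (eval0 (a_pol n varB)) = eval0 (a_pol n varA)" "cnj (dir_deriv u v (a_pol n varB)) = dir_deriv v u (a_pol n varA)" for n
    using a_pol_cnj[of 0 0 n] a_pol_cnj[OF assms(2,1), of n] by (metis complex_cnj_cnj Reals_0)+
  note c = a_pol_cnj[OF assms] BA
  have "eval0 (G n) = (\<Sum>l\<le>n. eval0 (a_pol (n - l) varA * a_pol l varB * const_AB ((1 + \<i>) ^ (n - l) * (1 - \<i>) ^ l)))"
    unfolding G_def eval0_simps by (rule sum.reindex_bij_witness[of _ "\<lambda>l. n - l" "\<lambda>l. n - l"]) auto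
  then show "cnj (eval0 (G n)) = eval0 (G n)"
    by (simp add: G_def c mult_ac)
  have "dir_deriv v u (G n) = (\<Sum>l\<le>n. dir_deriv v u (a_pol (n - l) varA * a_pol l varB * const_AB ((1 + \<i>) ^ (n - l) * (1 - \<i>) ^ l)))"
    unfolding G_def dir_deriv_sum by (rule sum.reindex_bij_witness[of _ "\<lambda>l. n - l" "\<lambda>l. n - l"]) auto
  then show "cnj (dir_deriv u v (G n)) = dir_deriv v u (G n)"
    by (simp add: G_def c algebra_simps)
qed

lemma inv_falling_cnj: "cnj (fps_nth (inv_falling n) m) = fps_nth (inv_falling n) m"
proof (induction m arbitrary: n)
  case 0
  then show ?case by (cases n) (auto simp: inv_falling_nth_eq_0)
next
  case (Suc m)
  then show ?case by (cases n) (auto simp: inv_falling_nth_Suc)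
qed

definition cnj_fps :: "complex fps \<Rightarrow> complex fps" where
  "cnj_fps f = Abs_fps (\<lambda>n. cnj (fps_nth f n))"

lemma cnj_fps_mult: "cnj_fps (f * h) = cnj_fps f * cnj_fps h"
  by (simp add: cnj_fps_def fps_eq_iff fps_mult_nth)

lemma F_cnj: "cnj_fps F0 = F0" "cnj_fps (F1 1 0) = F1 0 1"
  by (simp_all add: cnj_fps_def fps_eq_iff F0_def F1_def eval0_fps_def dir_fps_def F_def lift_fps_def
     G_cnj(1)[of 0 0] G_cnj(2) inv_falling_cnj)

definition "re_g = Abs_fps (\<lambda>n. complex_of_real (Re (g n)))"
definition "im_g = Abs_fps (\<lambda>n. complex_of_real (Im (g n)))"

text \<open>
  The conjugate of \<open>\<partial>\<^sub>A F\<close> at the origin is \<open>\<partial>\<^sub>B F\<close>, while \<open>F\<close> itself is real there.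
\<close>

lemma re_g_eq: "2 * re_g * F0 = F1 1 1"
  and im_g_eq: "2 * fps_const \<i> * im_g * F0 = F1 1 (-1)"
proof -
  have c: "cnj_fps g_fps * F0 = F1 0 1"
    using arg_cong[OF g_fps_eq, of cnj_fps] by (simp add: cnj_fps_mult F_cnj)
  have "2 * re_g = g_fps + cnj_fps g_fps"
    by (simp add: fps_eq_iff re_g_def g_fps_def cnj_fps_def numeral_fps_const complex_add_cnj)
  moreover have "F1 1 0 + F1 0 1 = F1 1 1"
    by (simp add: F1_def dir_fps_def fps_eq_iff dir_deriv_add)
  ultimately show "2 * re_g * F0 = F1 1 1"
    using c g_fps_eq by (simp add: distrib_right)
  have "2 * fps_const \<i> * im_g = g_fps - cnj_fps g_fps"
    by (simp add: fps_eq_iff im_g_def g_fps_def cnj_fps_def numeral_fps_const complex_diff_cnj mult.assoc)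
  moreover have "F1 1 0 - F1 0 1 = F1 1 (-1)"
    by (simp add: F1_def dir_fps_def fps_eq_iff dir_deriv_def algebra_simps)
  ultimately show "2 * fps_const \<i> * im_g * F0 = F1 1 (-1)"
    using c g_fps_eq by (simp add: left_diff_distrib)
qed

section \<open>Difference equations for the real and imaginary parts\<close>

abbreviation "ii \<equiv> fps_const \<i>"

lemma ii_ii: "ii * ii = - 1" "ii * (ii * f) = - f"
proof -
  show "ii * ii = - 1" by (simp add: fps_eq_iff)
  then show "ii * (ii * f) = - f" by (metis mult.assoc mult_minus1)
qed

lemma one_plus_numeral_X_nonzero [simp]: "1 + numeral k * fps_X \<noteq> (0 :: 'a::idom fps)" "1 + fps_X \<noteq> (0 :: 'a::idom fps)"
  using one_plus_X_nonzero[of "numeral k", where 'a = 'a] one_plus_X_nonzero[of 1, where 'a = 'a] by simp_all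

lemma one_plus_X_cancel: "(1 + fps_X) * f = (1 + fps_X) * h \<Longrightarrow> f = (h :: 'a::idom fps)"
  using one_plus_numeral_X_nonzero(2) by (metis mult_left_cancel)

lemma shift_X_numeral: "(1 + numeral k * fps_X) * shift_X (numeral k) = (fps_X :: 'a::comm_ring_1 fps)"
  using shift_X_mult[of "numeral k", where 'a = 'a] by simp

lemma flux_series_at_0: "eval0_fps flux_series = - 2 * ii * shift 2 F0"
proof -
  have "(1 + fps_X) * eval0_fps flux_series = (1 + fps_X) * (- 2 * ii * shift 2 F0)"
    using arg_cong[OF flux_series_eq, of eval0_fps] by (simp add: F0_def algebra_simps)
  then show ?thesis by (rule one_plus_X_cancel)
qed

text \<open>
  \<open>(Z + 1)\<^sup>2 F(Z) = Z (Z + 2) F(Z + 4)\<close> at the origin: here the two difference equations decouple after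
  eliminating the flux series.
\<close>

lemma F0_shift_4: "(1 + fps_X)\<^sup>2 * F0 = (1 + 2 * fps_X) * shift 4 F0"
proof -
  have "2 * (1 + fps_X) ^ 3 * F0 = ii * (1 + fps_X) * (1 + 2 * fps_X) * shift 2 (eval0_fps flux_series)"
    using arg_cong[OF F_eq_flux_series, of eval0_fps] by (simp add: F0_def)
  also have "shift 2 (eval0_fps flux_series) = - 2 * ii * shift 4 F0"
    unfolding flux_series_at_0 by (simp add: shift_mult shift_minus shift_shift)
  also have "ii * (1 + fps_X) * (1 + 2 * fps_X) * (- 2 * ii * shift 4 F0)
      = 2 * (1 + fps_X) * (1 + 2 * fps_X) * shift 4 F0"
    by (simp add: ii_ii algebra_simps)
  finally have "(2 * (1 + fps_X)) * ((1 + fps_X)\<^sup>2 * F0) = (2 * (1 + fps_X)) * ((1 + 2 * fps_X) * shift 4 F0)"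
    by (simp only: power3_eq_cube power2_eq_square mult_ac)
  then show ?thesis by simp
qed

text \<open>
  \<open>Re g(Z) - Re g(Z + 4) = 2 / (Z + 1)\<^sup>2\<close>. The direction \<open>(1, 1)\<close> annihilates \<open>A - B\<close>, so the elimination
  of the flux series is the same as at the origin, with \<open>4 (A + B)\<close> contributing the inhomogeneity.
\<close>

lemma re_g_shift: "(1 + fps_X)\<^sup>2 * (re_g - shift 4 re_g) = 2 * fps_X\<^sup>2"
proof -
  have "(1 + fps_X) * dir_fps 1 1 flux_series = (1 + fps_X) * (- 2 * ii * shift 2 (F1 1 1))"
    using arg_cong[OF flux_series_eq, of "dir_fps 1 1"] by (simp add: F1_def algebra_simps)
  then have rho1: "dir_fps 1 1 flux_series = - 2 * ii * shift 2 (F1 1 1)" by (rule one_plus_X_cancel)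
  have "2 * (1 + fps_X) ^ 3 * F1 1 1 - 8 * fps_X\<^sup>2 * (1 + fps_X) * F0
      = ii * (1 + fps_X) * (1 + 2 * fps_X) * shift 2 (dir_fps 1 1 flux_series)"
    using arg_cong[OF F_eq_flux_series, of "dir_fps 1 1"] by (simp add: F0_def F1_def numeral_fps_const)
  also have "shift 2 (dir_fps 1 1 flux_series) = - 2 * ii * shift 4 (F1 1 1)"
    unfolding rho1 by (simp add: shift_mult shift_minus shift_shift)
  also have "ii * (1 + fps_X) * (1 + 2 * fps_X) * (- 2 * ii * shift 4 (F1 1 1))
      = 2 * (1 + fps_X) * (1 + 2 * fps_X) * shift 4 (F1 1 1)"
    by (simp add: ii_ii algebra_simps)
  also have "\<dots> = 4 * (1 + fps_X) * ((1 + 2 * fps_X) * shift 4 F0) * shift 4 re_g"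
    unfolding re_g_eq[symmetric] shift_mult by (simp add: mult_ac)
  also have "\<dots> = 4 * (1 + fps_X) ^ 3 * F0 * shift 4 re_g"
    unfolding F0_shift_4[symmetric] by (simp only: power3_eq_cube power2_eq_square mult_ac)
  finally have "(4 * (1 + fps_X) * F0) * ((1 + fps_X)\<^sup>2 * (re_g - shift 4 re_g)) = (4 * (1 + fps_X) * F0) * (2 * fps_X\<^sup>2)"
    unfolding re_g_eq[symmetric] by (simp add: algebra_simps power2_eq_square power3_eq_cube)
  then show ?thesis by simp
qed

text \<open>
  In terms of \<open>x = (Z + 1)/4\<close> the ratio is a rational function times the expansion of
  \<open>(\<Gamma>(x + 1/2) / \<Gamma>(x))\<^sup>2\<close>.
\<close>

definition "F0_ratio = shift 2 F0 * inverse F0"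

lemma F0_ratio_mult: "F0_ratio * F0 = shift 2 F0"
  unfolding F0_ratio_def mult.assoc by (simp add: inverse_mult_eq_1)

lemma F0_ratio_nth_0 [simp]: "fps_nth F0_ratio 0 = 1"
  by (simp add: F0_ratio_def)

lemma F0_ratio_nonzero [simp]: "F0_ratio \<noteq> 0" "shift a F0_ratio \<noteq> 0"
  using F0_ratio_nth_0 shift_nth_0[of a F0_ratio] by (metis fps_zero_nth zero_neq_one)+

lemma F0_ratio_shift: "(1 + 2 * fps_X) * (F0_ratio * shift 2 F0_ratio) = (1 + fps_X)\<^sup>2"
proof -
  have "shift 2 F0_ratio * shift 2 F0 = shift 4 F0"
    using arg_cong[OF F0_ratio_mult, of "shift 2"] unfolding shift_mult shift_shift by simp
  then have "shift 2 F0_ratio * (F0_ratio * F0) = shift 4 F0"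
    unfolding F0_ratio_mult .
  then have "F0 * ((1 + 2 * fps_X) * (F0_ratio * shift 2 F0_ratio)) = (1 + 2 * fps_X) * shift 4 F0"
    by (simp add: mult_ac)
  then have "F0 * ((1 + 2 * fps_X) * (F0_ratio * shift 2 F0_ratio)) = F0 * (1 + fps_X)\<^sup>2"
    unfolding F0_shift_4[symmetric] by (simp add: mult_ac)
  then show ?thesis by simp
qed

text \<open>
  The direction \<open>(1, -1)\<close> annihilates \<open>A + B\<close> but not \<open>A - B\<close>, so the values of \<open>F\<close> and of the flux series at
  the origin enter both equations. They combine to a multiple of \<open>F(Z + 2)\<close>.
\<close>

lemma im_g_shift: "(1 + fps_X) ^ 3 * (1 + 3 * fps_X) * (im_g - shift 4 im_g) = 2 * fps_X\<^sup>2 * (1 + 2 * fps_X) * F0_ratio"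
proof -
  define r1 where "r1 = dir_fps 1 (-1) flux_series"
  define R where "R = shift 2 r1"
  define f where "f = F1 1 (-1)"
  let ?X = "fps_X :: complex fps" and ?s2 = "shift_X 2 :: complex fps"
  have s2: "(1 + 2 * ?X) * ?s2 = ?X" using shift_X_numeral[of "Num.Bit0 Num.One", where 'a = complex] by simp
  have "(1 + ?X) * r1 = 4 * ?X\<^sup>2 * F0 - 2 * ii * ((1 + ?X) * shift 2 f)"
    using arg_cong[OF flux_series_eq, of "dir_fps 1 (-1)"] by (simp add: F0_def F1_def r1_def f_def algebra_simps flip: numeral_fps_const)
  from arg_cong[OF this, of "shift 2"]
  have "(1 + ?s2) * R = 4 * ?s2\<^sup>2 * shift 2 F0 - 2 * ii * ((1 + ?s2) * shift 4 f)"
    by (simp add: shift_mult shift_add shift_diff shift_power shift_shift R_def)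
  \<comment> \<open>multiplication by \<open>(1 + 2 X)\<^sup>2\<close> clears the denominators of \<open>1 / (Z + 2)\<close>\<close>
  then have "(1 + 2 * ?X)\<^sup>2 * ((1 + ?s2) * R) = (1 + 2 * ?X)\<^sup>2 * (4 * ?s2\<^sup>2 * shift 2 F0 - 2 * ii * ((1 + ?s2) * shift 4 f))"
    by (rule arg_cong)
  moreover have s3: "(1 + 2 * ?X) * (1 + ?s2) = 1 + 3 * ?X"
    unfolding distrib_left s2 by simp
  moreover have "(1 + 2 * ?X)\<^sup>2 * ((1 + ?s2) * R) = (1 + 2 * ?X) * ((1 + 2 * ?X) * (1 + ?s2)) * R"
    by (simp only: power2_eq_square mult_ac)
  moreover have "(1 + 2 * ?X)\<^sup>2 * (4 * ?s2\<^sup>2 * shift 2 F0 - 2 * ii * ((1 + ?s2) * shift 4 f))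
      = 4 * ((1 + 2 * ?X) * ?s2)\<^sup>2 * shift 2 F0 - 2 * ii * ((1 + 2 * ?X) * ((1 + 2 * ?X) * (1 + ?s2))) * shift 4 f"
    by (simp only: power2_eq_square mult_ac right_diff_distrib)
  ultimately have R: "(1 + 2 * ?X) * (1 + 3 * ?X) * R
      = 4 * ?X\<^sup>2 * shift 2 F0 - 2 * ii * ((1 + 2 * ?X) * (1 + 3 * ?X)) * shift 4 f"
    unfolding s2 s3 by simp
  have e: "2 * (1 + ?X) ^ 3 * f = ii * (1 + ?X) * (1 + 2 * ?X) * R - 2 * ?X\<^sup>2 * eval0_fps flux_series"
    using arg_cong[OF F_eq_flux_series, of "dir_fps 1 (-1)"] by (simp add: F0_def F1_def r1_def f_def R_def numeral_fps_const)
  have "2 * ((1 + ?X) ^ 3 * (1 + 3 * ?X) * f) = (1 + 3 * ?X) * (2 * (1 + ?X) ^ 3 * f)"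
    by (simp only: mult_ac)
  also have "\<dots> = ii * (1 + ?X) * ((1 + 2 * ?X) * (1 + 3 * ?X) * R) + 4 * ii * ?X\<^sup>2 * (1 + 3 * ?X) * shift 2 F0"
    unfolding e flux_series_at_0 by (simp add: algebra_simps)
  also have "\<dots> = 2 * ((1 + ?X) * (1 + 3 * ?X) * ((1 + 2 * ?X) * shift 4 f) + 4 * ii * ?X\<^sup>2 * (1 + 2 * ?X) * shift 2 F0)"
    unfolding R by (simp add: algebra_simps ii_ii)
  also have "(1 + 2 * ?X) * shift 4 f = 2 * ii * ((1 + 2 * ?X) * shift 4 F0) * shift 4 im_g"
    unfolding f_def im_g_eq[symmetric] by (simp add: shift_mult mult_ac)
  also have "\<dots> = 2 * ii * (1 + ?X)\<^sup>2 * F0 * shift 4 im_g"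
    unfolding F0_shift_4[symmetric] by (simp add: mult_ac)
  also have "f = 2 * ii * im_g * F0"
    by (simp add: f_def im_g_eq)
  also have "shift 2 F0 = F0_ratio * F0"
    by (simp add: F0_ratio_mult)
  finally have "(4 * ii * F0) * ((1 + ?X) ^ 3 * (1 + 3 * ?X) * (im_g - shift 4 im_g))
      = (4 * ii * F0) * (2 * ?X\<^sup>2 * (1 + 2 * ?X) * F0_ratio)"
    by (simp add: algebra_simps power2_eq_square power3_eq_cube)
  moreover have "4 * ii * F0 \<noteq> 0" by simp
  ultimately show ?thesis
    by (rule mult_left_cancel[THEN iffD1, rotated])
qed

section \<open>Reflection and the Borel transform\<close>

text \<open>
  The substitution \<open>Z \<mapsto> - Z\<close>.
\<close>

definition reflect :: "'a::idom fps \<Rightarrow> 'a fps" where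
  "reflect f = f oo (- fps_X)"

lemma reflect_nth [simp]: "fps_nth (reflect f) n = (-1) ^ n * fps_nth f n"
  by (simp add: reflect_def fps_compose_uminus')

lemma reflect_simps [simp]:
  "reflect (f + h) = reflect f + reflect h" "reflect (f - h) = reflect f - reflect h" "reflect (f * h) = reflect f * reflect h"
  "reflect (f ^ n) = reflect f ^ n" "reflect 1 = 1" "reflect (numeral k) = numeral k" "reflect fps_X = - fps_X"
  by (simp_all add: reflect_def fps_compose_add_distrib fps_compose_sub_distrib fps_compose_mult_distrib
      fps_compose_power numeral_fps_const)

lemma reflect_shift_X: "reflect (shift_X a) = - shift_X (- a)"
proof -
  have "reflect ((1 + fps_const (of_int a) * fps_X) * shift_X a) = - (fps_X :: 'a fps)"
    using shift_X_mult[of a, where 'a = 'a] by (simp add: fps_of_int)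
  moreover have "reflect (fps_const (of_int a) :: 'a fps) = fps_const (of_int a)"
    by (simp add: reflect_def)
  ultimately have "(1 + of_int (- a) * fps_X) * (- reflect (shift_X a)) = (fps_X :: 'a fps)"
    by (simp add: fps_of_int)
  then have "- reflect (shift_X a) = (shift_X (- a) :: 'a fps)"
    by (rule shift_X_unique)
  then show ?thesis by (metis minus_minus)
qed

lemma reflect_shift: "reflect (shift a f) = shift (- a) (reflect f)"
proof -
  have "reflect (shift a f) = f oo reflect (shift_X a)"
    unfolding reflect_def shift_def by (rule fps_compose_assoc[symmetric]) simp_all
  also have "\<dots> = f oo ((- fps_X) oo shift_X (- a))"
    by (simp add: reflect_shift_X fps_compose_uminus)
  also have "\<dots> = shift (- a) (reflect f)"
    unfolding reflect_def shift_def by (rule fps_compose_assoc) simp_all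
  finally show ?thesis .
qed

text \<open>
  \<open>Z\<^sup>-\<^sup>n\<^sup>-\<^sup>1 \<mapsto> t\<^sup>n / n!\<close>; the constant term is dropped.
\<close>

definition borel_transform :: "'a::field_char_0 fps \<Rightarrow> 'a fps" where
  "borel_transform f = Abs_fps (\<lambda>n. fps_nth f (Suc n) / fact n)"

lemma shift_X_power_Suc_nth:
  "fps_nth (shift_X a ^ Suc i) (Suc m) = of_nat (m choose i) * (- of_int a :: 'a::comm_ring_1) ^ (m - i)"
proof (induction m arbitrary: i)
  case 0
  show ?case by (cases i) (simp_all add: shift_X_def fps_mult_nth)
next
  case (Suc m)
  have "(1 + of_int a * fps_X) * shift_X a ^ Suc i = fps_X * (shift_X a :: 'a fps) ^ i"
    using shift_X_mult[of a, where 'a = 'a] by (metis mult.assoc power_Suc)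
  then have "shift_X a ^ Suc i = fps_X * shift_X a ^ i - fps_const (of_int a :: 'a) * (fps_X * shift_X a ^ Suc i)"
    unfolding fps_of_int by (simp only: distrib_right mult_1_left mult.assoc eq_diff_eq)
  from arg_cong[OF this, of "\<lambda>f. fps_nth f (Suc (Suc m))"]
  have rec: "(fps_nth (shift_X a ^ Suc i) (Suc (Suc m)) :: 'a)
      = fps_nth (shift_X a ^ i) (Suc m) - of_int a * fps_nth (shift_X a ^ Suc i) (Suc m)"
    by (simp only: fps_sub_nth fps_mult_left_const_nth fps_X_mult_nth) simp
  show ?case
  proof (cases i)
    case 0
    then show ?thesis unfolding rec Suc.IH by simp
  next
    case (Suc j)
    show ?thesis
    proof (cases "i \<le> m")
      case True
      then have "m - j = Suc (m - i)" by (simp add: Suc)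
      then show ?thesis unfolding rec Suc.IH unfolding Suc Suc.IH using Suc True
        by (simp add: algebra_simps)
    next
      case False
      then show ?thesis unfolding rec Suc.IH unfolding Suc Suc.IH using Suc
        by (simp add: binomial_eq_0)
    qed
  qed
qed

text \<open>
  Formally \<open>f(Z) = \<integral> e\<^sup>-\<^sup>Z\<^sup>t h(t) dt\<close> for the Borel transform \<open>h\<close> of \<open>f\<close>, so \<open>Z \<mapsto> Z + a\<close> multiplies \<open>h\<close> by
  \<open>e\<^sup>-\<^sup>a\<^sup>t\<close>.
\<close>

lemma borel_transform_shift: "borel_transform (shift a f) = fps_exp (- of_int a) * borel_transform f"
proof (rule fps_ext)
  fix n
  have "fps_nth (shift a f) (Suc n) = (\<Sum>i\<le>n. fps_nth f (Suc i) * fps_nth (shift_X a ^ Suc i) (Suc n))"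
    unfolding shift_def fps_compose_nth atLeast0AtMost by (subst sum.atMost_Suc_shift) simp
  also have "\<dots> = (\<Sum>i\<le>n. fps_nth f (Suc i) * (of_nat (n choose i) * (- of_int a) ^ (n - i)))"
    unfolding shift_X_power_Suc_nth ..
  also have "\<dots> / fact n = (\<Sum>i\<le>n. fps_nth (borel_transform f) i * fps_nth (fps_exp (- of_int a)) (n - i))"
    unfolding sum_divide_distrib by (intro sum.cong refl) (simp add: borel_transform_def binomial_fact)
  finally show "fps_nth (borel_transform (shift a f)) n = fps_nth (fps_exp (- of_int a) * borel_transform f) n"
    by (subst mult.commute) (simp add: borel_transform_def fps_mult_nth atLeast0AtMost)
qed

lemma shift_fixed_imp_const:
  assumes "shift a f = (f :: 'a::field_char_0 fps)" "a \<noteq> 0"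
  shows "f = fps_const (fps_nth f 0)"
proof -
  have "borel_transform f * (fps_exp (- of_int a) - 1) = 0"
    using borel_transform_shift[of a f] assms(1) by (simp add: algebra_simps)
  then have "borel_transform f = 0"
    using assms(2) by simp
  then have "fps_nth f (Suc n) = 0" for n
    by (simp add: borel_transform_def fps_eq_iff)
  then show ?thesis
    by (auto simp: fps_eq_iff gr0_conv_Suc)
qed

section \<open>Parity of the imaginary part\<close>

text \<open>
  The ratio \<open>W\<close> solves \<open>W(Z) W(Z + 2) = (Z + 1)\<^sup>2 / (Z (Z + 2))\<close>. The right-hand side is invariant under
  \<open>Z \<mapsto> - Z - 2\<close>, so \<open>V(Z) = W(- Z)\<close> solves the same equation. Then \<open>q = V / W\<close> satisfies
  \<open>q(Z) q(Z + 2) = 1\<close>, hence \<open>q(Z + 4) = q(Z)\<close>, and a periodic power series in \<open>1/Z\<close> is constant.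
\<close>

lemma F0_ratio_even: "reflect F0_ratio = F0_ratio"
proof -
  let ?X = "fps_X :: complex fps" and ?s2 = "shift_X 2 :: complex fps"
  define V where "V = reflect F0_ratio"
  have s2: "(1 + 2 * ?X) * ?s2 = ?X" using shift_X_numeral[of "Num.Bit0 Num.One", where 'a = complex] by simp
  have "(1 - 2 * ?X) * (V * shift (- 2) V) = (1 - ?X)\<^sup>2"
    using arg_cong[OF F0_ratio_shift, of reflect] by (simp add: reflect_shift V_def)
  from arg_cong[OF this, of "shift 2"]
  have "(1 - 2 * ?s2) * (shift 2 V * V) = (1 - ?s2)\<^sup>2"
    by (simp add: shift_mult shift_diff shift_power shift_shift)
  then have "(1 + 2 * ?X)\<^sup>2 * ((1 - 2 * ?s2) * (shift 2 V * V)) = (1 + 2 * ?X)\<^sup>2 * (1 - ?s2)\<^sup>2"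
    by (rule arg_cong)
  then have "(1 + 2 * ?X) * ((1 + 2 * ?X) * (1 - 2 * ?s2)) * (V * shift 2 V) = ((1 + 2 * ?X) * (1 - ?s2))\<^sup>2"
    by (simp only: power2_eq_square mult_ac)
  moreover have "(1 + 2 * ?X) * (1 - 2 * ?s2) = 1 + 2 * ?X - 2 * ((1 + 2 * ?X) * ?s2)"
    by (simp add: algebra_simps)
  moreover have "(1 + 2 * ?X) * (1 - ?s2) = 1 + ?X"
    unfolding right_diff_distrib s2 by simp
  ultimately have "(1 + 2 * ?X) * (V * shift 2 V) = (1 + ?X)\<^sup>2"
    unfolding s2 by simp
  then have "(1 + 2 * ?X) * (V * shift 2 V) = (1 + 2 * ?X) * (F0_ratio * shift 2 F0_ratio)"
    unfolding F0_ratio_shift .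
  then have VW: "V * shift 2 V = F0_ratio * shift 2 F0_ratio"
    by (rule mult_left_cancel[THEN iffD1, rotated]) simp
  define q where "q = V * inverse F0_ratio"
  have q: "q * F0_ratio = V"
    unfolding q_def mult.assoc by (simp add: inverse_mult_eq_1)
  have "(q * shift 2 q) * (F0_ratio * shift 2 F0_ratio) = 1 * (F0_ratio * shift 2 F0_ratio)"
    using VW unfolding q[symmetric] shift_mult by (simp add: mult_ac)
  then have q1: "q * shift 2 q = 1"
    by (rule mult_right_cancel[THEN iffD1, rotated]) simp
  from arg_cong[OF this, of "shift 2"] have "shift 2 q * shift 4 q = 1"
    by (simp add: shift_mult shift_shift)
  then have "q * (shift 2 q * shift 4 q) = q" by simp
  then have "shift 4 q = q"
    unfolding mult.assoc[symmetric] q1 by simp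
  then have "q = fps_const (fps_nth q 0)"
    by (rule shift_fixed_imp_const) simp
  also have "fps_nth q 0 = 1"
    by (simp add: q_def V_def)
  finally have "q = 1" by simp
  then show ?thesis
    using q by (simp add: V_def)
qed

text \<open>
  Write \<open>r(Z) = Im g(Z) - Im g(Z + 4)\<close>. The equation of \<open>W\<close> yields
  \<open>(Z + 1) (Z + 3) r(Z) W(Z + 2) = 2\<close>, and, since \<open>W\<close> is even, the same equation for \<open>r(- Z - 4)\<close>. Therefore
  \<open>r(Z) = r(- Z - 4)\<close>, which says that \<open>Im g(Z) + Im g(- Z)\<close> has period \<open>4\<close>.
\<close>

lemma im_g_odd: "reflect im_g = - im_g"
proof -
  let ?X = "fps_X :: complex fps" and ?s = "shift_X 4 :: complex fps" and ?W = F0_ratio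
  define r where "r = im_g - shift 4 im_g"
  define t where "t = shift 4 (reflect r)"
  have s4: "(1 + 4 * ?X) * ?s = ?X" using shift_X_numeral[of "Num.Bit0 (Num.Bit0 Num.One)", where 'a = complex] by simp
  have s2: "(1 + 2 * ?X) * shift_X 2 = ?X" using shift_X_numeral[of "Num.Bit0 Num.One", where 'a = complex] by simp
  have c: "(1 + 4 * ?X) * (1 - ?s) = 1 + 3 * ?X" "(1 + 4 * ?X) * (1 - 2 * ?s) = 1 + 2 * ?X" "(1 + 4 * ?X) * (1 - 3 * ?s) = 1 + ?X"
    unfolding right_diff_distrib mult.left_commute[of "1 + 4 * ?X" "numeral _"] s4 by simp_all
  have c2: "(1 + 2 * ?X) * (1 + shift_X 2) = 1 + 3 * ?X" "(1 + 2 * ?X) * (1 + 2 * shift_X 2) = 1 + 4 * ?X"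
    unfolding distrib_left mult.left_commute[of "1 + 2 * ?X" "numeral _"] s2 by simp_all
  have r: "(1 + ?X) ^ 3 * (1 + 3 * ?X) * r = 2 * ?X\<^sup>2 * (1 + 2 * ?X) * ?W"
    using im_g_shift by (simp add: r_def)
  from arg_cong[OF this, of reflect]
  have "(1 - ?X) ^ 3 * (1 - 3 * ?X) * reflect r = 2 * ?X\<^sup>2 * (1 - 2 * ?X) * ?W"
    by (simp add: F0_ratio_even)
  from arg_cong[OF this, of "shift 4"]
  have "(1 - ?s) ^ 3 * (1 - 3 * ?s) * t = 2 * ?s\<^sup>2 * (1 - 2 * ?s) * shift 4 ?W"
    by (simp add: shift_mult shift_diff shift_power t_def)
  \<comment> \<open>\<open>?s\<close> is \<open>1 / (Z + 4)\<close>; on the left each of the four factors in \<open>?s\<close> absorbs one \<open>1 + 4 X\<close>\<close>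
  then have "(1 + 4 * ?X) ^ 4 * ((1 - ?s) ^ 3 * (1 - 3 * ?s) * t) = (1 + 4 * ?X) ^ 4 * (2 * ?s\<^sup>2 * (1 - 2 * ?s) * shift 4 ?W)"
    by (rule arg_cong)
  then have "((1 + 4 * ?X) * (1 - ?s)) ^ 3 * ((1 + 4 * ?X) * (1 - 3 * ?s)) * t
     = 2 * ((1 + 4 * ?X) * ?s)\<^sup>2 * ((1 + 4 * ?X) * (1 - 2 * ?s)) * ((1 + 4 * ?X) * shift 4 ?W)"
    by (simp only: power2_eq_square power3_eq_cube power4_eq_xxxx mult_ac)
  then have t: "(1 + 3 * ?X) ^ 3 * (1 + ?X) * t = 2 * ?X\<^sup>2 * (1 + 2 * ?X) * ((1 + 4 * ?X) * shift 4 ?W)"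
    unfolding c s4 .
  \<comment> \<open>the equation of \<open>W\<close> at \<open>Z + 2\<close> expresses \<open>W(Z + 4)\<close> by \<open>W(Z + 2)\<close>\<close>
  from arg_cong[OF F0_ratio_shift, of "shift 2"]
  have "(1 + 2 * shift_X 2) * (shift 2 ?W * shift 4 ?W) = (1 + shift_X 2)\<^sup>2"
    by (simp add: shift_mult shift_add shift_power shift_shift)
  then have "(1 + 2 * ?X)\<^sup>2 * ((1 + 2 * shift_X 2) * (shift 2 ?W * shift 4 ?W)) = (1 + 2 * ?X)\<^sup>2 * (1 + shift_X 2)\<^sup>2"
    by (rule arg_cong)
  then have "(1 + 2 * ?X) * ((1 + 2 * ?X) * (1 + 2 * shift_X 2)) * (shift 2 ?W * shift 4 ?W) = ((1 + 2 * ?X) * (1 + shift_X 2))\<^sup>2"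
    by (simp only: power2_eq_square mult_ac)
  then have W4: "(1 + 2 * ?X) * (1 + 4 * ?X) * (shift 2 ?W * shift 4 ?W) = (1 + 3 * ?X)\<^sup>2"
    unfolding c2 .
  have "(1 + 3 * ?X)\<^sup>2 * ((1 + 3 * ?X) * (1 + ?X) * t * shift 2 ?W) = ((1 + 3 * ?X) ^ 3 * (1 + ?X) * t) * shift 2 ?W"
    by (simp only: power2_eq_square power3_eq_cube mult_ac)
  also have "\<dots> = 2 * ?X\<^sup>2 * ((1 + 2 * ?X) * (1 + 4 * ?X) * (shift 2 ?W * shift 4 ?W))"
    unfolding t by (simp only: mult_ac)
  also have "\<dots> = (1 + 3 * ?X)\<^sup>2 * (2 * ?X\<^sup>2)"
    unfolding W4 by (simp only: mult_ac)
  finally have 1: "(1 + 3 * ?X) * (1 + ?X) * t * shift 2 ?W = 2 * ?X\<^sup>2"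
    by (rule mult_left_cancel[THEN iffD1, rotated]) simp
  have "(1 + ?X)\<^sup>2 * ((1 + 3 * ?X) * (1 + ?X) * r * shift 2 ?W) = ((1 + ?X) ^ 3 * (1 + 3 * ?X) * r) * shift 2 ?W"
    by (simp only: power2_eq_square power3_eq_cube mult_ac)
  also have "\<dots> = 2 * ?X\<^sup>2 * ((1 + 2 * ?X) * (?W * shift 2 ?W))"
    unfolding r by (simp only: mult_ac)
  also have "\<dots> = (1 + ?X)\<^sup>2 * (2 * ?X\<^sup>2)"
    unfolding F0_ratio_shift by (simp only: mult_ac)
  finally have 2: "(1 + 3 * ?X) * (1 + ?X) * r * shift 2 ?W = 2 * ?X\<^sup>2"
    by (rule mult_left_cancel[THEN iffD1, rotated]) simp
  have "((1 + 3 * ?X) * (1 + ?X) * shift 2 ?W) * r = ((1 + 3 * ?X) * (1 + ?X) * shift 2 ?W) * t"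
    using 1 2 by (simp only: mult_ac)
  then have "r = t"
    by (rule mult_left_cancel[THEN iffD1, rotated]) simp
  moreover have "t = shift 4 (reflect im_g) - reflect im_g"
    by (simp add: r_def t_def reflect_shift shift_diff shift_shift)
  moreover have "im_g + reflect im_g - shift 4 (im_g + reflect im_g)
      = (im_g - shift 4 im_g) - (shift 4 (reflect im_g) - reflect im_g)"
    by (simp add: shift_add)
  ultimately have "shift 4 (im_g + reflect im_g) = im_g + reflect im_g"
    unfolding r_def by (metis right_minus_eq)
  then have "im_g + reflect im_g = fps_const (fps_nth (im_g + reflect im_g) 0)"
    by (rule shift_fixed_imp_const) simp
  also have "fps_nth (im_g + reflect im_g) 0 = 0"
  proof -
    have "g 0 = 0" using arg_cong[OF g_fps_eq, of "\<lambda>f. fps_nth f 0"] by (simp add: g_fps_def)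
    then show ?thesis by (simp add: im_g_def)
  qed
  finally show ?thesis by (simp add: eq_neg_iff_add_eq_0 add.commute)
qed

corollary Im_g_even: "Im (g (2 * k)) = 0"
  using arg_cong[OF im_g_odd, of "\<lambda>f. fps_nth f (2 * k)"] by (simp add: im_g_def)

section \<open>The real part\<close>

text \<open>
  The Borel transform of \<open>Re g\<close>, as a series with real coefficients.
\<close>

definition phi :: "real fps" where
  "phi = Abs_fps (\<lambda>n. Re (g (Suc n)) / fact n)"

definition of_real_fps :: "real fps \<Rightarrow> complex fps" where
  "of_real_fps f = Abs_fps (\<lambda>n. complex_of_real (fps_nth f n))"

lemma of_real_fps_simps [simp]:
  "of_real_fps (f * h) = of_real_fps f * of_real_fps h" "of_real_fps (f - h) = of_real_fps f - of_real_fps h"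
  "of_real_fps 1 = 1" "of_real_fps (numeral k) = numeral k" "of_real_fps fps_X = fps_X"
  "of_real_fps (fps_exp c) = fps_exp (complex_of_real c)"
  by (auto simp: of_real_fps_def fps_eq_iff fps_mult_nth numeral_fps_const)

lemma of_real_fps_inj: "of_real_fps f = of_real_fps h \<Longrightarrow> f = h"
  by (simp add: of_real_fps_def fps_eq_iff)

lemma phi_eq: "phi * (1 - fps_exp (- 4)) = 2 * fps_X * fps_exp (- 1)"
proof -
  let ?s = "shift_X 1 :: complex fps"
  have "(1 + fps_X)\<^sup>2 * (2 * ?s\<^sup>2) = 2 * ((1 + fps_X) * ?s)\<^sup>2"
    by (simp only: power2_eq_square mult_ac)
  also have "(1 + fps_X) * ?s = fps_X"
    using shift_X_mult[of 1, where 'a = complex] by simp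
  finally have "(1 + fps_X)\<^sup>2 * (2 * ?s\<^sup>2) = (1 + fps_X)\<^sup>2 * (re_g - shift 4 re_g)"
    unfolding re_g_shift .
  then have "2 * ?s\<^sup>2 = re_g - shift 4 re_g"
    by (rule mult_left_cancel[THEN iffD1, rotated]) simp
  then have "re_g - shift 4 re_g = 2 * ?s\<^sup>2" ..
  also have "\<dots> = shift 1 (2 * fps_X\<^sup>2)"
    by (simp add: shift_mult shift_power)
  finally have "borel_transform (re_g - shift 4 re_g) = fps_exp (- 1) * borel_transform (2 * fps_X\<^sup>2)"
    by (simp add: borel_transform_shift)
  moreover have "borel_transform (2 * fps_X\<^sup>2) = (2 * fps_X :: complex fps)"
    by (auto simp: borel_transform_def fps_eq_iff numeral_fps_const le_Suc_eq)
  moreover have "borel_transform (re_g - shift 4 re_g) = borel_transform re_g * (1 - fps_exp (- 4))"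
  proof -
    have "borel_transform (re_g - shift 4 re_g) = borel_transform re_g - borel_transform (shift 4 re_g)"
      by (simp add: borel_transform_def fps_eq_iff diff_divide_distrib)
    then show ?thesis by (simp add: borel_transform_shift algebra_simps)
  qed
  moreover have "borel_transform re_g = of_real_fps phi"
    by (simp add: borel_transform_def re_g_def phi_def of_real_fps_def fps_eq_iff)
  ultimately have "of_real_fps (phi * (1 - fps_exp (- 4))) = of_real_fps (2 * fps_X * fps_exp (- 1))"
    by (simp add: mult_ac)
  then show ?thesis by (rule of_real_fps_inj)
qed

lemma fps_half: "2 * (f / 2) = (f :: real fps)"
  by (simp add: numeral_fps_const divide_fps_const fps_eq_iff)

lemma fps_sinh_2: "2 * fps_sinh 2 = fps_exp 2 - fps_exp (- 2)"
  and fps_cosh_1: "2 * fps_cosh 1 = fps_exp 1 + fps_exp (- 1)"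
  unfolding fps_sinh_def fps_cosh_def by (rule fps_half)+

lemma phi_exp: "phi * (fps_exp 2 - fps_exp (- 2)) = 2 * fps_X * fps_exp 1"
proof -
  have "phi * (fps_exp 2 - fps_exp (- 2)) = phi * (1 - fps_exp (- 4)) * fps_exp 2"
    by (simp add: algebra_simps flip: fps_exp_add_mult)
  also have "\<dots> = 2 * fps_X * fps_exp 1"
    unfolding phi_eq by (simp add: mult.assoc flip: fps_exp_add_mult)
  finally show ?thesis .
qed

lemma fps_Re_Phi: "fps_Re Phi = fps_X * phi"
proof (rule fps_ext)
  fix n
  have "Re (z / fact m) = Re z / fact m" for z m
    by (metis Re_divide_of_real of_real_fact)
  then show "fps_nth (fps_Re Phi) n = fps_nth (fps_X * phi) n"
    by (cases n) (simp_all add: fps_Re_def Phi_def phi_def)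
qed

lemma Phi_formula: "fps_Re Phi = fps_X\<^sup>2 * fps_exp 1 / fps_sinh 2"
proof -
  have "2 * (phi * fps_sinh 2) = 2 * (fps_X * fps_exp 1)"
    using phi_exp unfolding fps_sinh_2[symmetric] by (simp add: mult_ac)
  then have "phi * fps_sinh 2 = fps_X * fps_exp 1"
    by simp
  then have "fps_Re Phi * fps_sinh 2 = fps_X\<^sup>2 * fps_exp 1"
    by (simp add: fps_Re_Phi mult.assoc power2_eq_square)
  moreover have "fps_sinh 2 \<noteq> 0"
    using fps_sinh_2 by auto
  then have "fps_Re Phi * fps_sinh 2 / fps_sinh 2 = fps_Re Phi"
    by (rule nonzero_mult_div_cancel_right)
  ultimately show ?thesis
    by (simp only:)
qed

section \<open>Bernoulli and Euler numbers\<close>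

definition "bern_fps = (fps_X / (fps_exp 1 - 1) :: real fps)"
definition "bern2_fps = bern_fps oo (fps_const 2 * fps_X)"
definition "sech_fps = (1 / fps_cosh 1 :: real fps)"

lemma bern_fps_mult: "bern_fps * (fps_exp 1 - 1) = fps_X"
proof -
  have "subdegree (fps_exp 1 - 1 :: real fps) = 1"
    by (rule subdegreeI) auto
  then have "(fps_exp 1 - 1 :: real fps) dvd fps_X"
    by (subst fps_dvd_iff) auto
  then show ?thesis by (simp add: bern_fps_def)
qed

lemma bern2_fps_mult: "bern2_fps * (fps_exp 2 - 1) = 2 * fps_X"
  using arg_cong[OF bern_fps_mult, of "\<lambda>f. f oo (fps_const 2 * fps_X)"]
  by (simp add: bern2_fps_def fps_compose_mult_distrib fps_compose_sub_distrib numeral_fps_const)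

lemma sech_fps_mult: "sech_fps * (fps_exp 1 + fps_exp (- 1)) = 2"
proof -
  have "2 * fps_nth (fps_cosh 1) 0 = (2 :: real)"
    using arg_cong[OF fps_cosh_1, of "\<lambda>f. fps_nth f 0"] by (simp add: numeral_fps_const)
  then have "sech_fps * fps_cosh 1 = 1"
    unfolding sech_fps_def by (subst fps_divide_unit) (simp_all add: inverse_mult_eq_1)
  then show ?thesis
    unfolding fps_cosh_1[symmetric] by (simp add: mult.left_commute)
qed

text \<open>
  \<open>t / sinh t = 2 t / (e\<^sup>t - 1) - 2 t / (e\<^sup>2\<^sup>t - 1)\<close>.
\<close>

lemma csch_fps_mult: "(2 * bern_fps - bern2_fps) * (fps_exp 1 - fps_exp (- 1)) = 2 * fps_X"
proof -
  let ?E = "fps_exp 1 :: real fps"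
  have E2: "fps_exp 2 = ?E * ?E" and E1: "?E * fps_exp (- 1) = 1"
    by (simp_all flip: fps_exp_add_mult)
  have "?E * ((2 * bern_fps - bern2_fps) * (?E - fps_exp (- 1)))
      = (2 * bern_fps - bern2_fps) * (fps_exp 2 - ?E * fps_exp (- 1))"
    unfolding E2 by (simp add: algebra_simps)
  also have "\<dots> = 2 * (bern_fps * (?E - 1)) * (?E + 1) - bern2_fps * (fps_exp 2 - 1)"
    unfolding E1 unfolding E2 by (simp add: algebra_simps)
  also have "\<dots> = ?E * (2 * fps_X)"
    unfolding bern_fps_mult bern2_fps_mult by (simp add: algebra_simps)
  finally show ?thesis by simp
qed

text \<open>
  \<open>2 t e\<^sup>t / sinh 2t = t / sinh t + t / cosh t\<close>, because \<open>sinh 2t = 2 sinh t cosh t\<close> and \<open>e\<^sup>t = cosh t + sinh t\<close>. The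
  first summand is even and the second odd, so each coefficient sees only one of them.
\<close>

lemma phi_decomp: "2 * phi = (2 * bern_fps - bern2_fps) + fps_X * sech_fps"
proof -
  let ?E = "fps_exp 1 :: real fps" and ?I = "fps_exp (- 1) :: real fps" and ?c = "2 * bern_fps - bern2_fps"
  have E: "fps_exp 2 - fps_exp (- 2) = (?E - ?I) * (?E + ?I)"
    by (simp add: algebra_simps flip: fps_exp_add_mult)
  have "(?c + fps_X * sech_fps) * (fps_exp 2 - fps_exp (- 2))
      = (?c * (?E - ?I)) * (?E + ?I) + fps_X * (sech_fps * (?E + ?I)) * (?E - ?I)"
    unfolding E by (simp add: algebra_simps)
  also have "\<dots> = 2 * (2 * fps_X * ?E)"
    unfolding csch_fps_mult sech_fps_mult by (simp add: algebra_simps)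
  also have "\<dots> = 2 * phi * (fps_exp 2 - fps_exp (- 2))"
    unfolding phi_exp[symmetric] by (simp only: mult_ac)
  finally have "2 * phi * (fps_exp 2 - fps_exp (- 2)) = (?c + fps_X * sech_fps) * (fps_exp 2 - fps_exp (- 2))"
    by (rule sym)
  then show ?thesis
    by (rule mult_right_cancel[THEN iffD1, rotated]) simp
qed

lemma reflect_exp: "reflect (fps_exp c) = fps_exp (- c :: 'a::field_char_0)"
  unfolding fps_eq_iff reflect_nth fps_exp_nth power_minus[of c]
  by (simp only: times_divide_eq_right simp_thms)

lemma even_imp_odd_nth_0: "reflect f = f \<Longrightarrow> odd n \<Longrightarrow> fps_nth (f :: real fps) n = 0"
  using reflect_nth[of f n] by simp

lemma csch_even: "reflect (2 * bern_fps - bern2_fps) = 2 * bern_fps - bern2_fps"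
proof -
  define c where "c = 2 * bern_fps - bern2_fps"
  have c: "c * (fps_exp 1 - fps_exp (- 1)) = 2 * fps_X"
    unfolding c_def by (rule csch_fps_mult)
  have "reflect c * (fps_exp (- 1) - fps_exp 1) = - (2 * fps_X)"
    using arg_cong[OF c, of reflect] by (simp add: reflect_exp)
  also have "\<dots> = c * (fps_exp (- 1) - fps_exp 1)"
    unfolding c[symmetric] by (simp add: algebra_simps)
  finally show ?thesis
    unfolding c_def by simp
qed

lemma sech_even: "reflect sech_fps = sech_fps"
proof -
  have "reflect sech_fps * (fps_exp (- 1) + fps_exp 1) = 2"
    using arg_cong[OF sech_fps_mult, of reflect] by (simp add: reflect_exp)
  then have "reflect sech_fps * (fps_exp 1 + fps_exp (- 1)) = sech_fps * (fps_exp 1 + fps_exp (- 1))"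
    unfolding sech_fps_mult by (simp only: add.commute)
  moreover have "fps_exp 1 + fps_exp (- 1) \<noteq> (0 :: real fps)"
    using sech_fps_mult by auto
  ultimately show ?thesis by simp
qed

lemma bern_fps_nth: "fps_nth bern_fps n = bernoulli n / fact n"
  and bern2_fps_nth: "fps_nth bern2_fps n = 2 ^ n * (bernoulli n / fact n)"
  and sech_fps_nth: "fps_nth sech_fps n = euler n / fact n"
  by (simp_all only: bern2_fps_def fps_nth_compose_linear bernoulli_def euler_def bern_fps_def sech_fps_def)
     simp_all

lemma two_phi_nth: "2 * fps_nth phi n = (2 - 2 ^ n) * bernoulli n / fact n
    + (if n = 0 then 0 else euler (n - 1) / fact (n - 1))"
proof -
  have "fps_nth (2 * phi) n = fps_nth (2 * bern_fps - bern2_fps + fps_X * sech_fps) n"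
    by (simp only: phi_decomp)
  then show ?thesis
    by (simp add: numeral_fps_const bern_fps_nth bern2_fps_nth sech_fps_nth left_diff_distrib diff_divide_distrib)
qed

lemma Re_g_odd: "Re (g (2 * k + 1)) = (1 - 2 powi (2 * int k - 1)) * bernoulli (2 * k)"
proof -
  have "euler (2 * k - 1) = 0" if "k > 0"
    using even_imp_odd_nth_0[OF sech_even, of "2 * k - 1"] that by (simp add: sech_fps_nth)
  then have "2 * Re (g (2 * k + 1)) / fact (2 * k) = (2 - 2 ^ (2 * k)) * bernoulli (2 * k) / fact (2 * k)"
    using two_phi_nth[of "2 * k"] by (cases k) (simp_all add: phi_def)
  then have "2 * Re (g (2 * k + 1)) = (2 - 2 ^ (2 * k)) * bernoulli (2 * k)"
    by simp
  moreover have "\<dots> = 2 * ((1 - 2 ^ (2 * k) / 2) * bernoulli (2 * k))"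
    by (simp add: algebra_simps)
  ultimately have "Re (g (2 * k + 1)) = (1 - 2 ^ (2 * k) / 2) * bernoulli (2 * k)"
    by simp
  moreover have "(2::real) powi (2 * int k - 1) = 2 ^ (2 * k) / 2"
  proof -
    have "(2::real) powi (2 * int k - 1) = 2 powi int (2 * k) / 2 powi 1"
      by (simp add: power_int_diff)
    then show ?thesis by (simp only: power_int_of_nat power_int_1_right)
  qed
  ultimately show ?thesis by (simp only:)
qed

lemma Re_g_even:
  assumes "k \<ge> 1"
  shows "Re (g (2 * k)) = (2 * real k - 1) * euler (2 * k - 2) / 2"
proof -
  obtain j where k: "k = Suc j" using assms by (metis Suc_le_D One_nat_def)
  define n where "n = 2 * j + 1"
  have "fps_nth (2 * bern_fps - bern2_fps) n = 0"
    by (rule even_imp_odd_nth_0[OF csch_even]) (simp add: n_def)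
  then have "(2 - 2 ^ n) * bernoulli n = 0"
    by (simp add: numeral_fps_const bern_fps_nth bern2_fps_nth left_diff_distrib)
  then have "2 * Re (g (Suc n)) / fact n = euler (2 * j) / fact (2 * j)"
    using two_phi_nth[of n] by (simp add: phi_def n_def)
  then have "2 * Re (g (Suc n)) = euler (2 * j) / fact (2 * j) * fact n"
    by (simp only: divide_eq_eq) simp
  moreover have "(fact n :: real) = (2 * real j + 1) * fact (2 * j)"
    by (simp add: n_def)
  ultimately have "2 * Re (g (Suc n)) = (2 * real j + 1) * euler (2 * j)"
    by simp
  then have "Re (g (Suc n)) = (2 * real j + 1) * euler (2 * j) / 2"
    by simp
  moreover have "2 * k = Suc n" "2 * k - 2 = 2 * j" "2 * real k - 1 = 2 * real j + 1"
    by (simp_all add: k n_def)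
  ultimately show ?thesis
    by (simp only:)
qed

section \<open>The 2-adic valuation\<close>

definition frac_odd :: "real \<Rightarrow> bool" where
  "frac_odd x \<longleftrightarrow> (\<exists>a b :: int. odd a \<and> odd b \<and> x = of_int a / of_int b)"

definition frac_even :: "real \<Rightarrow> bool" where
  "frac_even x \<longleftrightarrow> (\<exists>a b :: int. even a \<and> odd b \<and> x = of_int a / of_int b)"

lemma frac_even_add:
  assumes "frac_even x" "frac_even y"
  shows "frac_even (x + y)"
proof -
  obtain a b c d :: int where *: "even a" "odd b" "even c" "odd d" "x = of_int a / of_int b" "y = of_int c / of_int d"
    using assms by (auto simp: frac_even_def)
  then have "of_int b \<noteq> (0::real)" "of_int d \<noteq> (0::real)" by auto
  then have "x + y = of_int (a * d + c * b) / of_int (b * d)"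
    using * by (simp add: field_simps)
  moreover have "even (a * d + c * b)" "odd (b * d)" using * by auto
  ultimately show ?thesis unfolding frac_even_def by blast
qed

lemma frac_even_0: "frac_even 0"
  unfolding frac_even_def by (rule exI[of _ 0], rule exI[of _ 1]) simp

lemma frac_even_sum: "(\<And>i. i \<in> I \<Longrightarrow> frac_even (x i)) \<Longrightarrow> frac_even (sum x I)"
proof (induction I rule: infinite_finite_induct)
  case (insert i I)
  then show ?case by (auto intro: frac_even_add)
qed (simp_all add: frac_even_0)

lemma frac_odd_times_even:
  assumes "frac_odd x" "frac_even y"
  shows "frac_even (x * y)"
proof -
  obtain a b c d :: int where "odd a" "odd b" "even c" "odd d" "x = of_int a / of_int b" "y = of_int c / of_int d"
    using assms by (auto simp: frac_even_def frac_odd_def)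
  then show ?thesis unfolding frac_even_def
    by (intro exI[of _ "a * c"] exI[of _ "b * d"]) auto
qed

lemma frac_odd_1_minus:
  assumes "frac_even y"
  shows "frac_odd (1 - y)"
proof -
  obtain c d :: int where "even c" "odd d" "y = of_int c / of_int d"
    using assms by (auto simp: frac_even_def)
  moreover from this have "of_int d \<noteq> (0::real)" by auto
  ultimately show ?thesis unfolding frac_odd_def
    by (intro exI[of _ "d - c"] exI[of _ d]) (auto simp: field_simps)
qed

text \<open>
  The coefficient of \<open>t\<^sup>n\<^sup>+\<^sup>1\<close> in \<open>\<phi>(t) (e\<^sup>2\<^sup>t - e\<^sup>-\<^sup>2\<^sup>t) = 2 t e\<^sup>t\<close>, times \<open>n!/2\<close>. Only odd \<open>e = n + 1 - j\<close> contribute,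
  and \<open>n! / (j! e!) = (n choose j) / e\<close>.
\<close>

lemma Re_g_rec: "2 * Re (g (Suc n)) = 1 - (\<Sum>j<n. 2 * Re (g (Suc j)) *
    (if even (n - j) then of_nat (n choose j) * 2 ^ (n - j) / of_nat (Suc (n - j)) else 0))"
proof -
  let ?e = "\<lambda>d. (2 ^ d - (- 2) ^ d) / fact d :: real"
  have "(\<Sum>j\<le>Suc n. fps_nth phi j * ?e (Suc n - j)) = fps_nth (phi * (fps_exp 2 - fps_exp (- 2))) (Suc n)"
    unfolding fps_mult_nth atLeast0AtMost by (simp add: diff_divide_distrib del: sum.atMost_Suc)
  also have "\<dots> = 2 / fact n"
    unfolding phi_exp by (simp add: numeral_fps_const mult.assoc)
  finally have "(\<Sum>j\<le>n. fps_nth phi j * ?e (Suc n - j)) = 2 / fact n"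
    by simp
  then have "(\<Sum>j<n. fps_nth phi j * ?e (Suc n - j)) + 4 * fps_nth phi n = 2 / fact n"
    by (simp add: lessThan_Suc_atMost[symmetric])
  then have "fact n / 2 * ((\<Sum>j<n. fps_nth phi j * ?e (Suc n - j)) + 4 * fps_nth phi n) = 1"
    by simp
  then have "2 * Re (g (Suc n)) = 1 - (\<Sum>j<n. fact n / 2 * (fps_nth phi j * ?e (Suc n - j)))"
    by (simp add: sum_distrib_left distrib_left phi_def)
  also have "(\<Sum>j<n. fact n / 2 * (fps_nth phi j * ?e (Suc n - j))) = (\<Sum>j<n. 2 * Re (g (Suc j)) *
    (if even (n - j) then of_nat (n choose j) * 2 ^ (n - j) / of_nat (Suc (n - j)) else 0))"
  proof (intro sum.cong refl)
    fix j assume "j \<in> {..<n}"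
    then have j: "Suc n - j = Suc (n - j)" "j \<le> n" by auto
    have f: "(fact (Suc (n - j)) :: real) = of_nat (Suc (n - j)) * fact (n - j)" by simp
    show "fact n / 2 * (fps_nth phi j * ?e (Suc n - j)) = 2 * Re (g (Suc j)) *
      (if even (n - j) then of_nat (n choose j) * 2 ^ (n - j) / of_nat (Suc (n - j)) else 0)"
      unfolding j(1) f using j(2) by (simp add: phi_def binomial_fact field_simps del: of_nat_Suc)
  qed
  finally show ?thesis .
qed

text \<open>
  In the recurrence \<open>n - j\<close> is positive and even wherever the coefficient is nonzero, so the power of two is
  even and the denominator \<open>n - j + 1\<close> is odd.
\<close>

lemma two_Re_g_frac_odd: "frac_odd (2 * Re (g (Suc n)))"
proof (induction n rule: less_induct)
  case (less n)
  show ?case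
    unfolding Re_g_rec[of n]
  proof (intro frac_odd_1_minus frac_even_sum frac_odd_times_even)
    fix j assume j: "j \<in> {..<n}"
    then show "frac_odd (2 * Re (g (Suc j)))" using less by simp
    have "frac_even (of_nat (n choose j) * 2 ^ (n - j) / of_nat (Suc (n - j)))" if "even (n - j)"
      unfolding frac_even_def using j that
      by (intro exI[of _ "int (n choose j) * 2 ^ (n - j)"] exI[of _ "int (Suc (n - j))"]) auto
    then show "frac_even (if even (n - j) then of_nat (n choose j) * 2 ^ (n - j) / of_nat (Suc (n - j)) else 0)"
      by (simp add: frac_even_0)
  qed
qed

lemma padic_val_2_half:
  assumes "odd a" "odd b"
  shows "padic_val 2 (of_int a / of_int (2 * b)) = - 1"
proof -
  define r :: rat where "r = of_int a / of_int (2 * b)"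
  obtain p q where pq: "quotient_of r = (p, q)" by fastforce
  have q0: "q > 0" using quotient_of_denom_pos[OF pq] .
  have cop: "coprime p q" using quotient_of_coprime[OF pq] .
  have "b \<noteq> 0" using assms by auto
  have "r = of_int p / of_int q" using quotient_of_div[OF pq] .
  then have "(of_int (p * (2 * b)) :: rat) = of_int (a * q)"
    using q0 \<open>b \<noteq> 0\<close> by (simp add: r_def field_simps)
  then have eq: "p * (2 * b) = a * q"
    by (simp only: of_int_eq_iff)
  then have "even (a * q)" by (metis dvd_triv_left dvd_mult dvd_mult2)
  then have "even q" using assms by simp
  then have p: "odd p" using cop by (metis coprime_common_divisor odd_one)
  obtain q' where q': "q = 2 * q'" using \<open>even q\<close> by blast
  then have "p * b = a * q'" using eq by simp
  then have "odd q'" using p assms by (metis even_mult_iff)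
  then have "multiplicity 2 q = 1"
    unfolding q' using multiplicity_times_same[of q' "2 :: int"] by (auto simp: not_dvd_imp_multiplicity_0)
  moreover have "multiplicity 2 p = 0" using p by (simp add: not_dvd_imp_multiplicity_0)
  ultimately show ?thesis
    unfolding padic_val_def r_def[symmetric] pq by simp
qed

lemma Re_g_padic:
  assumes "n \<ge> 1"
  shows "\<exists>r. Re (g n) = of_rat r \<and> r \<noteq> 0 \<and> padic_val 2 r = - 1"
proof -
  obtain m where n: "n = Suc m" using assms by (metis Suc_le_D One_nat_def)
  obtain a b :: int where ab: "odd a" "odd b" "2 * Re (g n) = of_int a / of_int b"
    using two_Re_g_frac_odd[of m] unfolding n frac_odd_def by blast
  show ?thesis
  proof (intro exI[of _ "of_int a / of_int (2 * b)"] conjI)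
    show "Re (g n) = of_rat (of_int a / of_int (2 * b))"
      using ab(3) by (simp add: of_rat_divide of_rat_mult)
    show "of_int a / of_int (2 * b) \<noteq> (0 :: rat)" using ab by auto
    show "padic_val 2 (of_int a / of_int (2 * b)) = - 1" using ab by (intro padic_val_2_half)
  qed
qed

theorem corollary1p4:
  shows "fps_Re Phi = fps_X ^ 2 * fps_exp 1 / fps_sinh 2
    \<and> (\<forall>k. Re (g (2 * k + 1)) = (1 - 2 powi (2 * int k - 1)) * bernoulli (2 * k))
    \<and> (\<forall>k\<ge>1. Re (g (2 * k)) = (2 * real k - 1) * euler (2 * k - 2) / 2)
    \<and> (\<forall>k\<ge>1. Im (g (2 * k)) = 0)
    \<and> (\<forall>n\<ge>1. \<exists>r. Re (g n) = of_rat r \<and> r \<noteq> 0 \<and> padic_val 2 r = - 1)"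
  using Phi_formula Re_g_odd Re_g_even Im_g_even Re_g_padic by blast

end
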